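(* Consider the control system $$\Sigma:\quad \dot\eta=f(\eta,\zeta),\qquad \dot\zeta=\upsilon,$$ with state $(\eta,\zeta)\in\mathbb{R}^{n_\eta}\times\mathbb{R}^{n_\zeta}$ and control input $\upsilon$. Suppose there exists a continuously differentiable function $\psi:\mathbb{R}^{n_\eta}\to\mathbb{R}^{n_\zeta}$ such that the control system $$\Sigma_\eta:\quad \dot\eta=f(\eta,\psi(\eta)+\widetilde\upsilon)$$ is $\delta_\exists$-ISS with respect to the input $\widetilde\upsilon$. Then for every $\lambda\in\mathbb{R}^+$ the state feedback control law $$\upsilon=k(\eta,\zeta,\widehat\upsilon)=-\lambda(\zeta-\psi(\eta))+\frac{\partial\psi}{\partial y}(\eta)f(\eta,\zeta)+\widehat\upsilon$$ renders the control system $\Sigma$ $\delta_\exists$-ISS with respect to the input $\widehat\upsilon$ (that is, the closed-loop system obtained from $\Sigma$ by substituting $\upsilon=k(\eta,\zeta,\widehat\upsilon)$ is $\delta_\exists$-ISS with input $\widehat\upsilon$).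
   Context: Here $\frac{\partial\psi}{\partial y}$ is the Jacobian of $\psi$. The inputs $\upsilon,\widetilde\upsilon,\widehat\upsilon$ take values in $\mathbb{R}^{n_\zeta}$. Control systems. A control system is a quadruple $\Sigma=(\mathbb{R}^n,\mathsf{U},\mathcal{U},F)$ where $\mathbb{R}^n$ is the state space; $\mathsf{U}\subseteq\mathbb{R}^m$ is the input set; $\mathcal{U}$ is the set of all measurable, locally essentially bounded functions of time from intervals $]a,b[\subseteq\mathbb{R}$, with $a<0<b$, to $\mathsf{U}$; and $F:\mathbb{R}^n\times\mathsf{U}\to\mathbb{R}^n$ is continuous and such that for every compact $Q\subset\mathbb{R}^n$ there is $Z>0$ with $\|F(x,u)-F(y,u)\|\le Z\|x-y\|$ for all $x,y\in Q$, $u\in\mathsf{U}$. A curve $\xi:]a,b[\to\mathbb{R}^n$ is a trajectory if there is $\upsilon\in\mathcal{U}$ with $\dot\xi(t)=F(\xi(t),\upsilon(t))$ for almost all $t\in]a,b[$. $\xi_{x\upsilon}(t)$ denotes the point reached at time $t$ under input $\upsilon$ from $x=\xi_{x\upsilon}(0)$. A system is forward complete if every trajectory is defined on an interval of the form $]a,\infty[$. $\|g\|_\infty$ denotes the essential supremum of $\|g(t)\|$ over $t\ge0$, with $\|\cdot\|$ the Euclidean norm. Comparison functions. A continuous $\gamma:\mathbb{R}_0^+\to\mathbb{R}_0^+$ is of class $\mathcal{K}$ if it is strictly increasing with $\gamma(0)=0$, and of class $\mathcal{K}_\infty$ if moreover $\gamma(r)\to\infty$ as $r\to\infty$. A continuous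 $\beta:\mathbb{R}_0^+\times\mathbb{R}_0^+\to\mathbb{R}_0^+$ is of class $\mathcal{KL}$ if $\beta(\cdot,s)\in\mathcal{K}_\infty$ for each fixed $s$, and for each fixed $r\ne0$ the map $s\mapsto\beta(r,s)$ is decreasing with $\beta(r,s)\to0$ as $s\to\infty$. $\delta_\exists$-ISS. A control system on $\mathbb{R}^n$ is $\delta_\exists$-ISS (with respect to its input) if it is forward complete and there exist a metric $\mathbf{d}$ on $\mathbb{R}^n$, $\beta\in\mathcal{KL}$ and $\gamma\in\mathcal{K}_\infty$ such that $\mathbf{d}(\xi_{x\upsilon}(t),\xi_{x'\upsilon'}(t))\le\beta(\mathbf{d}(x,x'),t)+\gamma(\|\upsilon-\upsilon'\|_\infty)$ for all $t\ge0$, $x,x'\in\mathbb{R}^n$, $\upsilon,\upsilon'\in\mathcal{U}$. *)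

theory Defs
  imports "HOL-Analysis.Analysis" "HOL-Probability.Essential_Supremum"
begin

section \<open>Inputs and trajectories\<close>

text \<open>
  Open time intervals \<open>]a,b[\<close> are \<^const>\<open>einterval\<close> \<open>a b\<close>, so that \<open>b = \<infinity>\<close> (and \<open>a = -\<infinity>\<close>) is
  allowed.  Inputs and curves are total functions on the reals of which only the values on the
  interval in question matter.
\<close>

definition admissible_input ::
  "'u::euclidean_space set \<Rightarrow> ereal \<Rightarrow> ereal \<Rightarrow> (real \<Rightarrow> 'u) \<Rightarrow> bool" where
  "admissible_input U a b \<upsilon> \<longleftrightarrow>
     \<upsilon> \<in> borel_measurable (lebesgue_on (einterval a b)) \<and>
     (\<forall>t \<in> einterval a b. \<upsilon> t \<in> U) \<and>
     (\<forall>K. compact K \<and> K \<subseteq> einterval a b \<longrightarrow>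
        (\<exists>C. AE t in lebesgue_on K. norm (\<upsilon> t) \<le> C))"

text \<open>
  Absolute continuity on \<open>[c,d]\<close>: \<open>D\<close> ranges over the finite families of non-overlapping compact
  intervals contained in \<open>[c,d]\<close>; \<open>Inf k\<close> and \<open>Sup k\<close> are the end points of \<open>k\<close>.
\<close>

definition absolutely_continuous_between ::
  "real \<Rightarrow> real \<Rightarrow> (real \<Rightarrow> 'x::real_normed_vector) \<Rightarrow> bool" where
  "absolutely_continuous_between c d \<xi> \<longleftrightarrow>
     (\<forall>\<epsilon>>0. \<exists>\<delta>>0. \<forall>D. D division_of \<Union>D \<and> \<Union>D \<subseteq> {c..d} \<and> (\<Sum>k\<in>D. Sup k - Inf k) < \<delta> \<longrightarrow>
        (\<Sum>k\<in>D. norm (\<xi> (Sup k) - \<xi> (Inf k))) < \<epsilon>)"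

text \<open>
  Trajectories are Caratheodory solutions: locally absolutely continuous curves that satisfy the
  differential equation almost everywhere.  Without absolute continuity the almost-everywhere
  equation would also be satisfied by curves of Cantor type and would not determine the motion.
\<close>

definition trajectory ::
  "'u::euclidean_space set \<Rightarrow> ('x::euclidean_space \<Rightarrow> 'u \<Rightarrow> 'x) \<Rightarrow> ereal \<Rightarrow> ereal \<Rightarrow>
   (real \<Rightarrow> 'u) \<Rightarrow> (real \<Rightarrow> 'x) \<Rightarrow> bool" where
  "trajectory U F a b \<upsilon> \<xi> \<longleftrightarrow>
     admissible_input U a b \<upsilon> \<and>
     (\<forall>c d. {c..d} \<subseteq> einterval a b \<longrightarrow> absolutely_continuous_between c d \<xi>) \<and>
     (AE t in lebesgue_on (einterval a b). (\<xi> has_vector_derivative F (\<xi> t) (\<upsilon> t)) (at t))"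

section \<open>Control systems\<close>

definition control_system ::
  "'u::euclidean_space set \<Rightarrow> ('x::euclidean_space \<Rightarrow> 'u \<Rightarrow> 'x) \<Rightarrow> bool" where
  "control_system U F \<longleftrightarrow>
     continuous_on (UNIV \<times> U) (\<lambda>(x, u). F x u) \<and>
     (\<forall>Q. compact Q \<longrightarrow>
        (\<exists>Z>0. \<forall>x\<in>Q. \<forall>y\<in>Q. \<forall>u\<in>U. norm (F x u - F y u) \<le> Z * norm (x - y)))"

text \<open>
  Every trajectory whose input is defined on \<open>]a,\<infinity>[\<close> extends, for that input, to \<open>]a,\<infinity>[\<close>.  The
  input has to be given on all of \<open>]a,\<infinity>[\<close>: an input on \<open>]a,b[\<close> is only locally essentially
  bounded there, and may itself be unbounded near \<open>b\<close>.
\<close>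

definition forward_complete ::
  "'u::euclidean_space set \<Rightarrow> ('x::euclidean_space \<Rightarrow> 'u \<Rightarrow> 'x) \<Rightarrow> bool" where
  "forward_complete U F \<longleftrightarrow>
     (\<forall>a b \<upsilon> \<xi>. a < 0 \<and> 0 < b \<and> admissible_input U a \<infinity> \<upsilon> \<and> trajectory U F a b \<upsilon> \<xi> \<longrightarrow>
        (\<exists>\<xi>'. trajectory U F a \<infinity> \<upsilon> \<xi>' \<and> (\<forall>t \<in> einterval a b. \<xi>' t = \<xi> t)))"

section \<open>Comparison functions\<close>

text \<open>Only the values at nonnegative arguments matter.\<close>

definition class_K :: "(real \<Rightarrow> real) \<Rightarrow> bool" where
  "class_K \<gamma> \<longleftrightarrow> continuous_on {0..} \<gamma> \<and> strict_mono_on {0..} \<gamma> \<and> \<gamma> 0 = 0"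

definition class_K_inf :: "(real \<Rightarrow> real) \<Rightarrow> bool" where
  "class_K_inf \<gamma> \<longleftrightarrow> class_K \<gamma> \<and> filterlim \<gamma> at_top at_top"

definition class_KL :: "(real \<Rightarrow> real \<Rightarrow> real) \<Rightarrow> bool" where
  "class_KL \<beta> \<longleftrightarrow>
     continuous_on ({0..} \<times> {0..}) (\<lambda>(r, s). \<beta> r s) \<and>
     (\<forall>s\<ge>0. class_K_inf (\<lambda>r. \<beta> r s)) \<and>
     (\<forall>r>0. antimono_on {0..} (\<beta> r) \<and> (\<beta> r \<longlongrightarrow> 0) at_top)"

section \<open>Incremental input-to-state stability\<close>

definition sup_norm :: "(real \<Rightarrow> 'u::real_normed_vector) \<Rightarrow> ereal" where
  "sup_norm g = esssup (lebesgue_on {0..}) (\<lambda>t. ereal (norm (g t)))"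

text \<open>
  The metric \<open>d\<close> is an arbitrary metric on the state space; it need not be the Euclidean one.  If
  \<open>\<upsilon> - \<upsilon>'\<close> is essentially unbounded, the right-hand side of the estimate is infinite and the
  estimate holds trivially.  The estimate is required of all trajectories on \<open>]a,\<infinity>[\<close> with the
  given inputs, so no selection of a solution from \<open>x = \<xi> 0\<close> is involved.
\<close>

definition delta_ISS ::
  "'u::euclidean_space set \<Rightarrow> ('x::euclidean_space \<Rightarrow> 'u \<Rightarrow> 'x) \<Rightarrow> bool" where
  "delta_ISS U F \<longleftrightarrow>
     forward_complete U F \<and>
     (\<exists>d \<beta> \<gamma>. Metric_space UNIV d \<and> class_KL \<beta> \<and> class_K_inf \<gamma> \<and>
        (\<forall>a a' \<upsilon> \<upsilon>' \<xi> \<xi>' t.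
           a < 0 \<and> a' < 0 \<and> trajectory U F a \<infinity> \<upsilon> \<xi> \<and> trajectory U F a' \<infinity> \<upsilon>' \<xi>' \<and> 0 \<le> t \<and>
           sup_norm (\<lambda>s. \<upsilon> s - \<upsilon>' s) < \<infinity> \<longrightarrow>
           d (\<xi> t) (\<xi>' t) \<le> \<beta> (d (\<xi> 0) (\<xi>' 0)) t +
             \<gamma> (real_of_ereal (sup_norm (\<lambda>s. \<upsilon> s - \<upsilon>' s)))))"

section \<open>Systems with an integrator and the backstepping feedback\<close>

definition integrator_system ::
  "(real^'n \<Rightarrow> real^'m \<Rightarrow> real^'n) \<Rightarrow> (real^'n) \<times> (real^'m) \<Rightarrow> real^'m \<Rightarrow> (real^'n) \<times> (real^'m)" where
  "integrator_system f = (\<lambda>(\<eta>, \<zeta>) \<upsilon>. (f \<eta> \<zeta>, \<upsilon>))"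

definition closed_loop :: "('x \<Rightarrow> 'u \<Rightarrow> 'x) \<Rightarrow> ('x \<Rightarrow> 'v \<Rightarrow> 'u) \<Rightarrow> 'x \<Rightarrow> 'v \<Rightarrow> 'x" where
  "closed_loop F k = (\<lambda>x v. F x (k x v))"

definition backstepping_feedback ::
  "real \<Rightarrow> (real^'n \<Rightarrow> real^'m) \<Rightarrow> (real^'n \<Rightarrow> real^'m \<Rightarrow> real^'n) \<Rightarrow>
   (real^'n) \<times> (real^'m) \<Rightarrow> real^'m \<Rightarrow> real^'m" where
  "backstepping_feedback c \<psi> f =
     (\<lambda>(\<eta>, \<zeta>) v. - c *\<^sub>R (\<zeta> - \<psi> \<eta>) + jacobian \<psi> (at \<eta>) *v f \<eta> \<zeta> + v)"

definition continuously_differentiable :: "(real^'n \<Rightarrow> real^'m) \<Rightarrow> bool" where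
  "continuously_differentiable \<psi> \<longleftrightarrow>
     (\<forall>y. \<psi> differentiable (at y)) \<and> continuous_on UNIV (\<lambda>y. jacobian \<psi> (at y))"

end

theory Submission
  imports Defs
begin

text \<open>
  In the coordinates \<open>(\<eta>, z)\<close> with the tracking error \<open>z = \<zeta> - \<psi>(\<eta>)\<close> the feedback cancels the
  derivative of \<open>\<psi>(\<eta>)\<close>, and the closed loop becomes the cascade
  \<open>z' = - c z + v\<close>, \<open>\<eta>' = f(\<eta>, \<psi>(\<eta>) + z)\<close>.  The first equation is linear and contracting; the second
  is the system assumed to be incrementally stable, driven by the input \<open>z\<close>
  (\<open>closed_loop_trajectoryD\<close>, \<open>closed_loop_trajectoryI\<close>).

  Forward completeness: the linear equation has a solution for all later times, which extends the
  given \<open>z\<close>; the given \<open>\<eta>\<close> is then extended by forward completeness of the subsystem with this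
  extension as input (\<open>closed_loop_forward_complete\<close>).

  Stability: measure states by \<open>d(\<eta>, \<eta>') + norm (z - z')\<close>, where \<open>d\<close> is the metric of the subsystem.
  The difference of two tracking errors satisfies
  \<open>norm (z t - z' t) \<le> exp (- c t) norm (z 0 - z' 0) + V / c\<close>, with \<open>V\<close> the essential supremum of
  the difference of the inputs.  Applying the estimate of the subsystem on \<open>[0, t]\<close> would feed in the
  initial error, which does not decay with \<open>t\<close>.  So it is applied twice, on \<open>[0, t/2]\<close> and, after
  a translation of time, on \<open>[t/2, t]\<close>; on the second half the error has decayed to the
  order of \<open>exp (- c t / 2)\<close>, and what the first half contributes is damped by \<open>\<beta>(\<cdot>, t/2)\<close>
  (\<open>cascade_comparison\<close>, \<open>closed_loop_incremental_estimate\<close>).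

  Solutions are in the sense of Caratheodory, so two facts about integrals on the line
  are established first: an absolutely continuous curve is the integral of its almost everywhere
  derivative, and an indefinite integral is differentiable almost everywhere.  As inputs are locally
  essentially bounded, every trajectory is in fact locally Lipschitz, and all manipulations
  of curves take place in that class (\<open>trajectory_iff_ae_primitive\<close>).
\<close>

section \<open>Absolutely continuous curves as integrals of their derivatives\<close>

text \<open>
  The integral is a gauge integral.  At a tag outside \<open>N\<close> the gauge makes the increment of
  \<open>\<xi>\<close> close to \<open>g t\<close> times the length.  At a tag in \<open>N\<close> it forces the interval into an open
  neighbourhood of \<open>N\<close> of small measure, where absolute continuity makes the sum of the increments
  small, whatever the tags are.
\<close>
lemma has_integral_derivative_of_absolutely_continuous:
  fixes \<xi> g :: "real \<Rightarrow> 'x::euclidean_space"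
  assumes cd: "c \<le> d" and ac: "absolutely_continuous_between c d \<xi>" and N: "negligible N"
    and der: "\<And>t. t \<in> {c..d} - N \<Longrightarrow> (\<xi> has_vector_derivative g t) (at t within {c..d})"
  shows "(g has_integral \<xi> d - \<xi> c) {c..d}"
proof -
  define h where "h t = (if t \<in> N then 0 else g t)" for t
  have "(h has_integral \<xi> d - \<xi> c) (cbox c d)"
    unfolding has_integral
  proof (intro allI impI)
    fix e :: real assume "e > 0"
    obtain \<delta> where "\<delta> > 0" and \<delta>: "\<And>D. D division_of \<Union>D \<Longrightarrow> \<Union>D \<subseteq> {c..d} \<Longrightarrow>
        (\<Sum>k\<in>D. Sup k - Inf k) < \<delta> \<Longrightarrow> (\<Sum>k\<in>D. norm (\<xi> (Sup k) - \<xi> (Inf k))) < e/2"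
      using ac \<open>e > 0\<close> unfolding absolutely_continuous_between_def by (meson half_gt_zero)
    have "N \<in> null_sets lebesgue" using N by (simp add: negligible_iff_null_sets)
    then obtain V where V: "open V" "N \<subseteq> V" "V - N \<in> lmeasurable" "emeasure lebesgue (V - N) < ennreal \<delta>"
      using sets_lebesgue_outer_open[of N \<delta>] \<open>\<delta> > 0\<close> by auto
    have "emeasure lebesgue V = emeasure lebesgue (V - N)"
      using \<open>N \<in> null_sets lebesgue\<close> V by (simp add: emeasure_Diff_null_set)
    with V have eV: "emeasure lebesgue V < ennreal \<delta>" by simp
    then have Vm: "V \<in> lmeasurable"
      using V(1) by (intro fmeasurableI) (auto simp: less_top[symmetric] intro: order.strict_trans)
    then have Vd: "measure lebesgue V < \<delta>"
      using eV by (simp add: emeasure_eq_measure2 ennreal_less_iff)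
    \<comment> \<open>The summand \<open>1\<close> keeps the denominator positive when \<open>c = d\<close>.\<close>
    define e' where "e' = e / 2 / (d - c + 1)"
    have "e' > 0" using \<open>e > 0\<close> cd by (simp add: e'_def)
    have "\<forall>t. \<exists>r>0. t \<in> {c..d} - N \<longrightarrow> (\<forall>s\<in>{c..d}. norm (s - t) < r \<longrightarrow>
        norm (\<xi> s - \<xi> t - (s - t) *\<^sub>R g t) \<le> e' * norm (s - t))"
    proof
      fix t
      show "\<exists>r>0. t \<in> {c..d} - N \<longrightarrow> (\<forall>s\<in>{c..d}. norm (s - t) < r \<longrightarrow>
        norm (\<xi> s - \<xi> t - (s - t) *\<^sub>R g t) \<le> e' * norm (s - t))"
      proof (cases "t \<in> {c..d} - N")
        case True
        from der[OF this] \<open>e' > 0\<close> show ?thesis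
          unfolding has_vector_derivative_def has_derivative_within_alt by blast
      qed (auto intro: zero_less_one)
    qed
    then obtain r where r: "\<And>t. r t > 0" and
      r': "\<And>t s. t \<in> {c..d} - N \<Longrightarrow> s \<in> {c..d} \<Longrightarrow> norm (s - t) < r t \<Longrightarrow>
        norm (\<xi> s - \<xi> t - (s - t) *\<^sub>R g t) \<le> e' * norm (s - t)"
      by metis
    define G where "G t = (if t \<in> N then V else ball t (r t))" for t
    show "\<exists>\<gamma>. gauge \<gamma> \<and> (\<forall>p. p tagged_division_of cbox c d \<and> \<gamma> fine p \<longrightarrow>
       norm ((\<Sum>(x, k)\<in>p. measure lborel k *\<^sub>R h x) - (\<xi> d - \<xi> c)) < e)"
    proof (intro exI conjI allI impI)
      show "gauge G"
        using V r by (auto simp: gauge_def G_def)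
      fix p assume "p tagged_division_of cbox c d \<and> G fine p"
      then have p: "p tagged_division_of {c..d}" and fine: "G fine p" by auto
      have fin: "finite p" using p by auto
      \<comment> \<open>Passing from a sum over tags to a sum over intervals needs the value \<open>0\<close> on all intervals without interior, the empty one included.\<close>
      define A where "A k = (if k = {} then 0 else norm (\<xi> (Sup k) - \<xi> (Inf k)))" for k
      define p1 where "p1 = {(x,k)\<in>p. x \<in> N}"
      have itv: "\<exists>u v. u \<le> v \<and> k = {u..v} \<and> x \<in> {u..v} \<and> {u..v} \<subseteq> {c..d}" if "(x,k) \<in> p" for x k
        using tagged_division_ofD(2,3,4)[OF p that] by (metis atLeastAtMost_iff box_real(2) order_trans)
      have le: "norm (measure lborel k *\<^sub>R h x - (\<xi> (Sup k) - \<xi> (Inf k))) \<le> (if x \<in> N then A k else 0) + e' * measure lborel k"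
        if xk: "(x,k) \<in> p" for x k
      proof -
        obtain u v where uv: "u \<le> v" "k = {u..v}" "x \<in> {u..v}" "{u..v} \<subseteq> {c..d}"
          using itv[OF xk] by blast
        show ?thesis
        proof (cases "x \<in> N")
          case True
          then show ?thesis using \<open>e' > 0\<close> uv by (simp add: h_def A_def norm_minus_commute)
        next
          case False
          have "k \<subseteq> ball x (r x)" using fineD[OF fine xk] False by (simp add: G_def)
          moreover have "u \<in> k" "v \<in> k" using uv by auto
          ultimately have "u \<in> ball x (r x)" "v \<in> ball x (r x)" by blast+
          then have nu: "norm (u - x) < r x" and nv: "norm (v - x) < r x"
            by (simp_all add: dist_norm norm_minus_commute)
          have x: "x \<in> {c..d} - N" using uv False by auto
          have "norm (\<xi> u - \<xi> x - (u - x) *\<^sub>R g x) \<le> e' * (x - u)"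
            using r'[OF x _ nu] uv by auto
          moreover have "norm (\<xi> v - \<xi> x - (v - x) *\<^sub>R g x) \<le> e' * (v - x)"
            using r'[OF x _ nv] uv by auto
          moreover have "norm ((v - u) *\<^sub>R g x - (\<xi> v - \<xi> u)) \<le>
              norm (\<xi> u - \<xi> x - (u - x) *\<^sub>R g x) + norm (\<xi> v - \<xi> x - (v - x) *\<^sub>R g x)"
            by (rule order_trans[OF _ norm_triangle_ineq4]) (simp add: algebra_simps)
          ultimately have "norm ((v - u) *\<^sub>R g x - (\<xi> v - \<xi> u)) \<le> e' * (x - u) + e' * (v - x)"
            by linarith
          then show ?thesis using uv False by (simp add: h_def algebra_simps)
        qed
      qed
      have p1: "p1 tagged_division_of (\<Union>(snd ` p1))"
      proof (rule tagged_partial_division_of_Union_self)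
        show "p1 tagged_partial_division_of {c..d}"
          using p unfolding tagged_division_of_def
          by (rule conjE) (erule tagged_partial_division_subset, auto simp: p1_def)
      qed
      then have D: "snd ` p1 division_of \<Union>(snd ` p1)"
        by (rule division_of_tagged_division)
      have sub: "\<Union>(snd ` p1) \<subseteq> {c..d}" "\<Union>(snd ` p1) \<subseteq> V"
        using itv by (force simp: p1_def) (use fineD[OF fine] in \<open>force simp: p1_def G_def\<close>)
      have "(\<Sum>k\<in>snd ` p1. Sup k - Inf k) = (\<Sum>k\<in>snd ` p1. measure lebesgue k)"
        by (rule sum.cong) (use itv in \<open>force simp: p1_def\<close>)+
      also have "\<dots> = measure lebesgue (\<Union>(snd ` p1))"
        using content_division[OF D] by simp
      also have "\<dots> \<le> measure lebesgue V"
        using sub Vm D by (intro measure_mono_fmeasurable) (auto intro: fmeasurableD lmeasurable_division)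
      also have "\<dots> < \<delta>" by (rule Vd)
      finally have "(\<Sum>k\<in>snd ` p1. norm (\<xi> (Sup k) - \<xi> (Inf k))) < e/2"
        by (intro \<delta> D sub)
      also have "(\<Sum>k\<in>snd ` p1. norm (\<xi> (Sup k) - \<xi> (Inf k))) = (\<Sum>k\<in>snd ` p1. A k)"
        using division_ofD(3)[OF D] by (intro sum.cong) (auto simp: A_def)
      finally have "(\<Sum>k\<in>snd ` p1. A k) < e/2" .
      moreover have "(\<Sum>(x,k)\<in>p1. A k) = (\<Sum>k\<in>snd ` p1. A k)"
        by (rule sum.over_tagged_division_lemma[OF p1]) (auto simp: A_def antisym)
      ultimately have 1: "(\<Sum>(x,k)\<in>p1. A k) < e/2" by simp
      have "(\<Sum>(x,k)\<in>p. e' * measure lborel k) = e' * (d - c)"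
        using additive_content_tagged_division[of p c d] p cd
        by (simp add: sum_distrib_left[symmetric] split_def)
      also have "\<dots> \<le> e/2"
        using cd \<open>e > 0\<close> by (simp add: e'_def field_simps)
      finally have 2: "(\<Sum>(x,k)\<in>p. e' * measure lborel k) \<le> e/2" .
      have "(\<Sum>(x, k)\<in>p. measure lborel k *\<^sub>R h x) - (\<xi> d - \<xi> c) =
          (\<Sum>(x, k)\<in>p. measure lborel k *\<^sub>R h x - (\<xi> (Sup k) - \<xi> (Inf k)))"
        using additive_tagged_division_1[OF cd p, of \<xi>] by (simp add: split_def sum_subtractf)
      also have "norm \<dots> \<le> (\<Sum>(x, k)\<in>p. (if x \<in> N then A k else 0) + e' * measure lborel k)"
        by (rule sum_norm_le[THEN order_trans], rule order_refl) (use le in \<open>auto intro!: sum_mono\<close>)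
      also have "\<dots> = (\<Sum>(x,k)\<in>p. if x \<in> N then A k else 0) + (\<Sum>(x,k)\<in>p. e' * measure lborel k)"
        by (simp add: split_def sum.distrib)
      also have "(\<Sum>(x,k)\<in>p. if x \<in> N then A k else 0) = (\<Sum>(x,k)\<in>p1. A k)"
        using fin by (auto simp: p1_def split_def sum.inter_filter[symmetric] intro!: sum.cong)
      finally show "norm ((\<Sum>(x, k)\<in>p. measure lborel k *\<^sub>R h x) - (\<xi> d - \<xi> c)) < e"
        using 1 2 by linarith
    qed
  qed
  then show ?thesis
    using has_integral_spike[OF N, of "{c..d}" g h] by (auto simp: h_def)
qed

lemma lipschitz_on_imp_absolutely_continuous:
  fixes \<xi> :: "real \<Rightarrow> 'x::real_normed_vector"
  assumes lip: "L-lipschitz_on {c..d} \<xi>"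
  shows "absolutely_continuous_between c d \<xi>"
  unfolding absolutely_continuous_between_def
proof (intro allI impI)
  fix \<epsilon> :: real assume "\<epsilon> > 0"
  have "L \<ge> 0" using lip by (rule lipschitz_on_nonneg)
  show "\<exists>\<delta>>0. \<forall>D. D division_of \<Union>D \<and> \<Union>D \<subseteq> {c..d} \<and> (\<Sum>k\<in>D. Sup k - Inf k) < \<delta> \<longrightarrow>
        (\<Sum>k\<in>D. norm (\<xi> (Sup k) - \<xi> (Inf k))) < \<epsilon>"
  proof (intro exI[of _ "\<epsilon> / (L + 1)"] conjI allI impI)
    show "\<epsilon> / (L + 1) > 0" using \<open>\<epsilon> > 0\<close> \<open>L \<ge> 0\<close> by simp
    fix D assume D: "D division_of \<Union>D \<and> \<Union>D \<subseteq> {c..d} \<and> (\<Sum>k\<in>D. Sup k - Inf k) < \<epsilon> / (L + 1)"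
    have itv: "Inf k \<le> Sup k \<and> norm (\<xi> (Sup k) - \<xi> (Inf k)) \<le> L * (Sup k - Inf k)" if k: "k \<in> D" for k
    proof -
      have "k \<noteq> {}" "\<exists>a b. k = cbox a b" using D k division_ofD(3,4) by blast+
      then obtain u v where uv: "k = {u..v}" "u \<le> v" by auto
      moreover have "k \<subseteq> {c..d}" using D k by blast
      ultimately have "u \<in> {c..d}" "v \<in> {c..d}" by auto
      from lipschitz_onD[OF lip this(2,1)] show ?thesis using uv by (simp add: dist_norm)
    qed
    have "(\<Sum>k\<in>D. norm (\<xi> (Sup k) - \<xi> (Inf k))) \<le> L * (\<Sum>k\<in>D. Sup k - Inf k)"
      unfolding sum_distrib_left by (rule sum_mono) (use itv in blast)
    also have "\<dots> \<le> (L + 1) * (\<Sum>k\<in>D. Sup k - Inf k)"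
      using itv by (intro mult_right_mono sum_nonneg) auto
    also have "\<dots> < \<epsilon>" using D \<open>L \<ge> 0\<close> by (simp add: field_simps)
    finally show "(\<Sum>k\<in>D. norm (\<xi> (Sup k) - \<xi> (Inf k))) < \<epsilon>" .
  qed
qed

lemma absolutely_continuous_imp_continuous_on:
  fixes \<xi> :: "real \<Rightarrow> 'x::real_normed_vector"
  assumes ac: "absolutely_continuous_between c d \<xi>"
  shows "continuous_on {c..d} \<xi>"
  unfolding continuous_on_iff
proof (intro ballI allI impI)
  fix s and \<epsilon> :: real assume s: "s \<in> {c..d}" and "\<epsilon> > 0"
  then obtain \<delta> where "\<delta> > 0" and \<delta>: "\<And>D. D division_of \<Union>D \<Longrightarrow> \<Union>D \<subseteq> {c..d} \<Longrightarrow>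
        (\<Sum>k\<in>D. Sup k - Inf k) < \<delta> \<Longrightarrow> (\<Sum>k\<in>D. norm (\<xi> (Sup k) - \<xi> (Inf k))) < \<epsilon>"
    using ac unfolding absolutely_continuous_between_def by meson
  have *: "norm (\<xi> v - \<xi> u) < \<epsilon>" if "u \<le> v" "{u..v} \<subseteq> {c..d}" "v - u < \<delta>" for u v
    using \<delta>[of "{{u..v}}"] that division_of_self[of u v] by auto
  show "\<exists>\<delta>>0. \<forall>t\<in>{c..d}. dist t s < \<delta> \<longrightarrow> dist (\<xi> t) (\<xi> s) < \<epsilon>"
  proof (intro exI[of _ \<delta>] conjI ballI impI \<open>\<delta> > 0\<close>)
    fix t assume t: "t \<in> {c..d}" "dist t s < \<delta>"
    show "dist (\<xi> t) (\<xi> s) < \<epsilon>"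
      using *[of s t] *[of t s] s t
      by (cases "s \<le> t") (auto simp: dist_norm norm_minus_commute)
  qed
qed

section \<open>Differentiation of indefinite integrals\<close>

text \<open>
  Every exceptional \<open>t\<close> lies in arbitrarily short intervals, with \<open>t\<close> as an end point, on which the
  integral of \<open>g\<close> differs from \<open>g t\<close> times the length by more than \<open>e\<close> times the length.  Vitali's
  covering theorem extracts disjoint ones that cover almost all exceptional points.  Finitely
  many of these form a partial tagged division, so Henstock's lemma bounds the sum of their
  deviations, and hence their total length, by an arbitrarily small number.
\<close>
lemma integral_diff_quotient_exceptional_set_negligible:
  fixes g :: "real \<Rightarrow> 'x::euclidean_space"
  assumes g: "g integrable_on {c..d}" and "e > 0"
  defines "G \<equiv> (\<lambda>u. integral {c..u} g)"
  shows "negligible {t \<in> {c..d}. \<forall>\<delta>>0. \<exists>u\<in>{c..d}. 0 < \<bar>u - t\<bar> \<and> \<bar>u - t\<bar> < \<delta> \<and>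
                        norm (G u - G t - (u - t) *\<^sub>R g t) > e * \<bar>u - t\<bar>}" (is "negligible ?E")
  unfolding negligible_outer_le
proof (intro allI impI)
  fix \<epsilon> :: real assume "\<epsilon> > 0"
  have "e * \<epsilon> > 0" using \<open>e > 0\<close> \<open>\<epsilon> > 0\<close> by simp
  then obtain \<gamma> where "gauge \<gamma>" and \<gamma>: "\<And>p. p tagged_partial_division_of (cbox c d) \<Longrightarrow> \<gamma> fine p \<Longrightarrow>
       (\<Sum>(x,k)\<in>p. norm (measure lborel k *\<^sub>R g x - integral k g)) < e * \<epsilon>"
    using Henstock_lemma[of g c d "e * \<epsilon>"] g by auto
  have "\<forall>t. \<exists>\<rho>>0. ball t \<rho> \<subseteq> \<gamma> t"
    using \<open>gauge \<gamma>\<close> by (meson gauge_def openE)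
  then obtain \<rho> where \<rho>: "\<And>t. \<rho> t > 0" "\<And>t. ball t (\<rho> t) \<subseteq> \<gamma> t" by metis
  \<comment> \<open>A pair \<open>(t,u)\<close> stands for the interval with end points \<open>t\<close> and \<open>u\<close>, tagged at \<open>t\<close>; \<open>a\<close> and \<open>r\<close> are its centre and radius.\<close>
  define a where "a i = (fst i + snd i) / 2" for i :: "real \<times> real"
  define r where "r i = \<bar>snd i - fst i\<bar> / 2" for i :: "real \<times> real"
  define K where "K = {(t,u). t \<in> {c..d} \<and> u \<in> {c..d} \<and> u \<noteq> t \<and> \<bar>u - t\<bar> < \<rho> t \<and>
      norm (G u - G t - (u - t) *\<^sub>R g t) > e * \<bar>u - t\<bar>}"
  have rpos: "r i > 0" if "i \<in> K" for i using that by (auto simp: K_def r_def)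
  have cb: "cball (a (t,u)) (r (t,u)) = {min t u..max t u}" for t u
    by (auto simp: a_def r_def cball_eq_atLeastAtMost min_def max_def field_simps)
  obtain C where C: "countable C" "C \<subseteq> K"
     "pairwise (\<lambda>i j. disjnt (cball (a i) (r i)) (cball (a j) (r j))) C"
     "negligible (?E - (\<Union>i\<in>C. cball (a i) (r i)))"
  proof (rule Vitali_covering_theorem_cballs[of K r ?E a])
    show "0 < r i" if "i \<in> K" for i using rpos that .
    fix t \<delta> :: real assume t: "t \<in> ?E" and "\<delta> > 0"
    then have "min (\<rho> t) \<delta> > 0" using \<rho> by simp
    with t obtain u where u: "u \<in> {c..d}" "0 < \<bar>u - t\<bar>" "\<bar>u - t\<bar> < min (\<rho> t) \<delta>"
        "norm (G u - G t - (u - t) *\<^sub>R g t) > e * \<bar>u - t\<bar>" by blast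
    show "\<exists>i. i \<in> K \<and> t \<in> cball (a i) (r i) \<and> r i < \<delta>"
    proof (intro exI[of _ "(t,u)"] conjI)
      show "(t, u) \<in> K" using t u by (auto simp: K_def)
      show "t \<in> cball (a (t, u)) (r (t, u))" unfolding cb by simp
      show "r (t, u) < \<delta>" using u \<open>\<delta> > 0\<close> by (simp add: r_def)
    qed
  qed
  have bound: "measure lebesgue (\<Union>i\<in>F. cball (a i) (r i)) \<le> \<epsilon>" if F: "F \<subseteq> C" "finite F" for F
  proof -
    define q where "q i = (fst i, cball (a i) (r i))" for i
    have FK: "F \<subseteq> K" using F C by blast
    have dj: "disjnt (cball (a i) (r i)) (cball (a j) (r j))" if "i \<in> F" "j \<in> F" "i \<noteq> j" for i j
      using C(3) F that by (auto simp: pairwise_def)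
    have inj: "inj_on q F"
    proof (rule inj_onI, rule ccontr)
      fix i j assume ij: "i \<in> F" "j \<in> F" "q i = q j" "i \<noteq> j"
      then have "cball (a i) (r i) = {}" using dj[OF ij(1,2,4)] by (simp add: q_def disjnt_def)
      then show False using rpos[of i] ij FK by force
    qed
    have "q ` F tagged_partial_division_of cbox c d"
    proof (unfold tagged_partial_division_of_def, intro conjI allI impI)
      show "finite (q ` F)" using F by simp
    next
      fix x k assume "(x,k) \<in> q ` F"
      then obtain u where u: "(x,u) \<in> F" "k = {min x u..max x u}" by (auto simp: q_def cb)
      then show "x \<in> k" "k \<subseteq> cbox c d" "\<exists>a b. k = cbox a b" using FK by (auto simp: K_def)
    next
      fix x1 k1 x2 k2 assume *: "(x1,k1) \<in> q ` F \<and> (x2,k2) \<in> q ` F \<and> (x1,k1) \<noteq> (x2,k2)"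
      then obtain i j where "i \<in> F" "j \<in> F" "q i = (x1,k1)" "q j = (x2,k2)" by (metis imageE)
      then have "disjnt k1 k2" using dj[of i j] * by (auto simp: q_def)
      then show "interior k1 \<inter> interior k2 = {}"
        unfolding disjnt_def using interior_subset by blast
    qed
    moreover have "\<gamma> fine q ` F"
    proof (rule fineI)
      fix x k assume "(x,k) \<in> q ` F"
      then obtain u where u: "(x,u) \<in> F" "k = {min x u..max x u}" by (auto simp: q_def cb)
      then have "\<bar>u - x\<bar> < \<rho> x" using FK by (auto simp: K_def)
      then have "k \<subseteq> ball x (\<rho> x)" using u by (auto simp: dist_real_def min_def max_def split: if_splits)
      then show "k \<subseteq> \<gamma> x" using \<rho> by blast
    qed
    ultimately have "(\<Sum>(x,k)\<in>q ` F. norm (measure lborel k *\<^sub>R g x - integral k g)) < e * \<epsilon>"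
      by (rule \<gamma>)
    also have "(\<Sum>(x,k)\<in>q ` F. norm (measure lborel k *\<^sub>R g x - integral k g)) =
        (\<Sum>i\<in>F. norm (measure lborel (cball (a i) (r i)) *\<^sub>R g (fst i) - integral (cball (a i) (r i)) g))"
      by (subst sum.reindex[OF inj]) (simp add: q_def)
    finally have 1: "(\<Sum>i\<in>F. norm (measure lborel (cball (a i) (r i)) *\<^sub>R g (fst i) - integral (cball (a i) (r i)) g)) < e * \<epsilon>" .
    have "e * (\<Sum>i\<in>F. measure lborel (cball (a i) (r i))) \<le>
        (\<Sum>i\<in>F. norm (measure lborel (cball (a i) (r i)) *\<^sub>R g (fst i) - integral (cball (a i) (r i)) g))"
      unfolding sum_distrib_left
    proof (rule sum_mono)
      fix i assume "i \<in> F"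
      obtain t u where i: "i = (t,u)" by force
      have tu: "t \<in> {c..d}" "u \<in> {c..d}" "norm (G u - G t - (u - t) *\<^sub>R g t) > e * \<bar>u - t\<bar>"
        using \<open>i \<in> F\<close> FK i by (auto simp: K_def)
      have int: "integral {s..w} g = G w - G s" if "s \<le> w" "s \<in> {c..d}" "w \<in> {c..d}" for s w
      proof -
        have "g integrable_on {c..w}" using g that by (auto intro: integrable_on_subinterval)
        then show ?thesis
          using Henstock_Kurzweil_Integration.integral_combine[of c s w g] that unfolding G_def by (simp add: algebra_simps)
      qed
      have "norm (measure lborel {min t u..max t u} *\<^sub>R g t - integral {min t u..max t u} g)
          = norm (G u - G t - (u - t) *\<^sub>R g t)"
      proof (cases "t \<le> u")
        case True
        then show ?thesis using int[of t u] tu by (simp add: norm_minus_commute)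
      next
        case False
        then have "measure lborel {min t u..max t u} *\<^sub>R g t - integral {min t u..max t u} g
           = G u - G t - (u - t) *\<^sub>R g t"
          using int[of u t] tu by (simp add: algebra_simps)
        then show ?thesis by simp
      qed
      moreover have "measure lborel {min t u..max t u} = \<bar>u - t\<bar>" by auto
      ultimately show "e * measure lborel (cball (a i) (r i)) \<le>
         norm (measure lborel (cball (a i) (r i)) *\<^sub>R g (fst i) - integral (cball (a i) (r i)) g)"
        unfolding i cb using tu(3) by simp
    qed
    with 1 have "e * (\<Sum>i\<in>F. measure lborel (cball (a i) (r i))) < e * \<epsilon>" by linarith
    then have "(\<Sum>i\<in>F. measure lborel (cball (a i) (r i))) < \<epsilon>" using \<open>e > 0\<close> by simp
    moreover have "measure lebesgue (\<Union>i\<in>F. cball (a i) (r i)) \<le> (\<Sum>i\<in>F. measure lebesgue (cball (a i) (r i)))"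
      by (rule measure_UNION_le[OF \<open>finite F\<close>]) auto
    ultimately show ?thesis by simp
  qed
  let ?U = "\<Union>i\<in>C. cball (a i) (r i)"
  have U: "?U \<in> lmeasurable" "measure lebesgue ?U \<le> \<epsilon>"
    using C(1) bound by (auto intro!: fmeasurable_UN_bound[of C _ _ \<epsilon>] measure_UN_bound[of C _ _ \<epsilon>])
  have N: "?E - ?U \<in> null_sets lebesgue" using C(4) by (simp add: negligible_iff_null_sets)
  show "\<exists>T. ?E \<subseteq> T \<and> T \<in> lmeasurable \<and> measure lebesgue T \<le> \<epsilon>"
  proof (intro exI[of _ "?U \<union> (?E - ?U)"] conjI)
    show "?U \<union> (?E - ?U) \<in> lmeasurable"
      using U(1) C(4) by (intro fmeasurable.Un) (auto intro: negligible_imp_measurable)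
    show "measure lebesgue (?U \<union> (?E - ?U)) \<le> \<epsilon>"
      using measure_Un_null_set[OF fmeasurableD[OF U(1)] N] U(2) by simp
  qed blast
qed

text \<open>
  Lebesgue's differentiation theorem on the line.  The points where it fails are exceptional for
  one of the countably many tolerances \<open>1/(n+1)\<close>.
\<close>
lemma integral_has_vector_derivative_ae:
  fixes g :: "real \<Rightarrow> 'x::euclidean_space"
  assumes g: "g integrable_on {c..d}"
  obtains N where "negligible N"
    "\<And>t. t \<in> {c<..<d} - N \<Longrightarrow> ((\<lambda>u. integral {c..u} g) has_vector_derivative g t) (at t)"
proof -
  define G where "G = (\<lambda>u. integral {c..u} g)"
  define E where "E e = {t \<in> {c..d}. \<forall>\<delta>>0. \<exists>u\<in>{c..d}. 0 < \<bar>u - t\<bar> \<and> \<bar>u - t\<bar> < \<delta> \<and>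
                        norm (G u - G t - (u - t) *\<^sub>R g t) > e * \<bar>u - t\<bar>}" for e
  have "negligible (\<Union>n::nat. E (inverse (real (Suc n))))"
    using integral_diff_quotient_exceptional_set_negligible[OF g] 
    by (intro negligible_countable_Union) (auto simp: E_def G_def)
  moreover have "(G has_vector_derivative g t) (at t)"
    if t: "t \<in> {c<..<d} - (\<Union>n::nat. E (inverse (real (Suc n))))" for t
  proof -
    have "(G has_derivative (\<lambda>h. h *\<^sub>R g t)) (at t within {c..d})"
      unfolding has_derivative_within_alt
    proof (intro conjI allI impI)
      show "bounded_linear (\<lambda>h. h *\<^sub>R g t)" by (rule bounded_linear_scaleR_left)
      fix e :: real assume "e > 0"
      then obtain n where n: "inverse (real (Suc n)) < e" using reals_Archimedean by blast
      have "t \<notin> E (inverse (real (Suc n)))" using t by blast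
      then obtain \<delta> where \<delta>: "\<delta> > 0" "\<And>u. u\<in>{c..d} \<Longrightarrow> 0 < \<bar>u - t\<bar> \<Longrightarrow> \<bar>u - t\<bar> < \<delta> \<Longrightarrow>
            norm (G u - G t - (u - t) *\<^sub>R g t) \<le> inverse (real (Suc n)) * \<bar>u - t\<bar>"
        using t unfolding E_def by (force simp: not_less)
      show "\<exists>\<delta>>0. \<forall>u\<in>{c..d}. norm (u - t) < \<delta> \<longrightarrow> norm (G u - G t - (u - t) *\<^sub>R g t) \<le> e * norm (u - t)"
      proof (intro exI[of _ \<delta>] conjI ballI impI \<open>\<delta> > 0\<close>)
        fix u assume u: "u \<in> {c..d}" "norm (u - t) < \<delta>"
        show "norm (G u - G t - (u - t) *\<^sub>R g t) \<le> e * norm (u - t)"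
        proof (cases "u = t")
          case False
          then have "norm (G u - G t - (u - t) *\<^sub>R g t) \<le> inverse (real (Suc n)) * \<bar>u - t\<bar>"
            using \<delta>(2)[of u] u by simp
          also have "\<dots> \<le> e * norm (u - t)" using n by (simp add: mult_right_mono)
          finally show ?thesis .
        qed simp
      qed
    qed
    moreover have "at t within {c..d} = at t"
      using t by (intro at_within_interior) (simp add: interior_atLeastAtMost_real)
    ultimately show ?thesis by (simp add: has_vector_derivative_def)
  qed
  ultimately show ?thesis using that unfolding G_def by blast
qed

section \<open>Locally Lipschitz curves with a prescribed velocity\<close>

lemma AE_lebesgue_on_iff_negligible:
  assumes "S \<in> sets lebesgue"
  shows "(AE t in lebesgue_on S. P t) \<longleftrightarrow> negligible {t \<in> S. \<not> P t}"
proof -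
  have "(AE t in lebesgue_on S. P t) \<longleftrightarrow> (AE t in lebesgue. t \<in> S \<longrightarrow> P t)"
    using assms by (intro AE_restrict_space_iff) simp
  also have "\<dots> \<longleftrightarrow> negligible {t \<in> S. \<not> P t}"
    unfolding eventually_ae_filter_negligible by (auto intro: negligible_subset)
  finally show ?thesis .
qed

lemma has_integral_norm_bound_ae:
  fixes g :: "real \<Rightarrow> 'x::euclidean_space"
  assumes g: "(g has_integral i) S" and \<phi>: "(\<phi> has_integral j) S" and N: "negligible N"
    and le: "\<And>t. t \<in> S - N \<Longrightarrow> norm (g t) \<le> \<phi> t"
  shows "norm i \<le> j"
proof -
  have g': "((\<lambda>t. if t \<in> N then 0 else g t) has_integral i) S"
    by (rule has_integral_spike[OF N _ g]) simp
  have \<phi>': "((\<lambda>t. if t \<in> N then 0 else \<phi> t) has_integral j) S"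
    by (rule has_integral_spike[OF N _ \<phi>]) simp
  have "norm (integral S (\<lambda>t. if t \<in> N then 0 else g t)) \<le> integral S (\<lambda>t. if t \<in> N then 0 else \<phi> t)"
    using g' \<phi>' le by (intro integral_norm_bound_integral) auto
  then show ?thesis using g' \<phi>' by (simp add: integral_unique)
qed

text \<open>
  Trajectories belong to this class because their inputs are locally essentially bounded.  Asking for
  Lipschitz continuity instead of absolute continuity turns the closure under pairing, products and
  compositions into statements about Lipschitz constants on compact intervals.
\<close>
definition ae_primitive :: "real set \<Rightarrow> (real \<Rightarrow> 'x::euclidean_space) \<Rightarrow> (real \<Rightarrow> 'x) \<Rightarrow> bool" where
  "ae_primitive S g \<xi> \<longleftrightarrow>
     (\<forall>c d. {c..d} \<subseteq> S \<longrightarrow> (\<exists>L. L-lipschitz_on {c..d} \<xi>)) \<and>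
     negligible {t \<in> S. \<not> (\<xi> has_vector_derivative g t) (at t)}"

lemma ae_primitive_continuous_on:
  assumes "ae_primitive S g \<xi>" "{c..d} \<subseteq> S"
  shows "continuous_on {c..d} \<xi>"
  using assms unfolding ae_primitive_def by (meson lipschitz_on_continuous_on)

lemma ae_primitive_continuous_on_open:
  assumes "ae_primitive S g \<xi>" "open S"
  shows "continuous_on S \<xi>"
proof (rule continuous_at_imp_continuous_on, rule ballI)
  fix t assume "t \<in> S"
  then obtain e where e: "e > 0" "cball t e \<subseteq> S" using \<open>open S\<close> open_contains_cball by blast
  then have "continuous_on {t - e..t + e} \<xi>"
    using assms(1) by (intro ae_primitive_continuous_on) (auto simp: cball_eq_atLeastAtMost)
  then show "isCont \<xi> t"
    using e by (intro continuous_on_interior[of "{t - e..t + e}"]) auto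
qed

lemma ae_primitive_subset:
  "ae_primitive S g \<xi> \<Longrightarrow> T \<subseteq> S \<Longrightarrow> ae_primitive T g \<xi>"
  unfolding ae_primitive_def by (auto elim!: negligible_subset)

lemma ae_primitive_has_integral:
  assumes "ae_primitive S g \<xi>" "{c..d} \<subseteq> S" "c \<le> d"
  shows "(g has_integral \<xi> d - \<xi> c) {c..d}"
proof (rule has_integral_derivative_of_absolutely_continuous)
  show "absolutely_continuous_between c d \<xi>"
    using assms unfolding ae_primitive_def by (meson lipschitz_on_imp_absolutely_continuous)
  show "negligible {t \<in> S. \<not> (\<xi> has_vector_derivative g t) (at t)}"
    using assms unfolding ae_primitive_def by blast
  show "(\<xi> has_vector_derivative g t) (at t within {c..d})"
    if "t \<in> {c..d} - {t \<in> S. \<not> (\<xi> has_vector_derivative g t) (at t)}" for t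
    using that assms(2) by (auto intro: has_vector_derivative_at_within)
qed fact

lemma ae_primitive_compose:
  fixes \<Phi> :: "'x::euclidean_space \<Rightarrow> 'y::euclidean_space"
  assumes \<xi>: "ae_primitive S g \<xi>"
    and lip: "\<And>R. \<exists>L. L-lipschitz_on (cball 0 R) \<Phi>"
    and der: "\<And>x. (\<Phi> has_derivative \<Phi>' x) (at x)"
  shows "ae_primitive S (\<lambda>t. \<Phi>' (\<xi> t) (g t)) (\<lambda>t. \<Phi> (\<xi> t))"
  unfolding ae_primitive_def
proof (intro conjI allI impI)
  fix c d assume cd: "{c..d} \<subseteq> S"
  then obtain L where L: "L-lipschitz_on {c..d} \<xi>" using \<xi> unfolding ae_primitive_def by blast
  have "bounded (\<xi> ` {c..d})"
    using ae_primitive_continuous_on[OF \<xi> cd] by (intro compact_imp_bounded compact_continuous_image) auto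
  then obtain R where "\<forall>x\<in>\<xi> ` {c..d}. norm x \<le> R" unfolding bounded_iff by blast
  then have "\<xi> ` {c..d} \<subseteq> cball 0 R" by auto
  moreover obtain M where "M-lipschitz_on (cball 0 R) \<Phi>" using lip by blast
  ultimately have "M-lipschitz_on (\<xi> ` {c..d}) \<Phi>" by (meson lipschitz_on_subset)
  then show "\<exists>L. L-lipschitz_on {c..d} (\<lambda>t. \<Phi> (\<xi> t))"
    using lipschitz_on_compose2[OF L] by blast
next
  have "((\<lambda>t. \<Phi> (\<xi> t)) has_vector_derivative \<Phi>' (\<xi> t) (g t)) (at t)"
    if "(\<xi> has_vector_derivative g t) (at t)" for t
    using vector_derivative_diff_chain_within[OF that, of \<Phi> "\<Phi>' (\<xi> t)"] der[of "\<xi> t"]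
    by (simp add: o_def has_derivative_at_withinI)
  then have "{t \<in> S. \<not> ((\<lambda>t. \<Phi> (\<xi> t)) has_vector_derivative \<Phi>' (\<xi> t) (g t)) (at t)}
      \<subseteq> {t \<in> S. \<not> (\<xi> has_vector_derivative g t) (at t)}" by blast
  then show "negligible {t \<in> S. \<not> ((\<lambda>t. \<Phi> (\<xi> t)) has_vector_derivative \<Phi>' (\<xi> t) (g t)) (at t)}"
    using \<xi> unfolding ae_primitive_def by (meson negligible_subset)
qed

lemma ae_primitive_bounded_linear:
  fixes \<Phi> :: "'x::euclidean_space \<Rightarrow> 'y::euclidean_space"
  assumes "ae_primitive S g \<xi>" and bl: "bounded_linear \<Phi>"
  shows "ae_primitive S (\<lambda>t. \<Phi> (g t)) (\<lambda>t. \<Phi> (\<xi> t))"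
proof (rule ae_primitive_compose[OF assms(1)])
  show "\<exists>L. L-lipschitz_on (cball 0 R) \<Phi>" for R
    by (rule bounded_linear.lipschitz_boundE[OF bl]) blast
  show "(\<Phi> has_derivative \<Phi>) (at x)" for x
    by (rule bounded_linear_imp_has_derivative[OF bl])
qed

lemma ae_primitive_Pair:
  assumes "ae_primitive S g \<xi>" "ae_primitive S h \<zeta>"
  shows "ae_primitive S (\<lambda>t. (g t, h t)) (\<lambda>t. (\<xi> t, \<zeta> t))"
  unfolding ae_primitive_def
proof (intro conjI allI impI)
  fix c d assume "{c..d} \<subseteq> S"
  then obtain L M where "L-lipschitz_on {c..d} \<xi>" "M-lipschitz_on {c..d} \<zeta>"
    using assms unfolding ae_primitive_def by blast
  then show "\<exists>L. L-lipschitz_on {c..d} (\<lambda>t. (\<xi> t, \<zeta> t))" by (blast intro: lipschitz_on_Pair)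
next
  have "negligible ({t \<in> S. \<not> (\<xi> has_vector_derivative g t) (at t)} \<union>
                    {t \<in> S. \<not> (\<zeta> has_vector_derivative h t) (at t)})"
    using assms unfolding ae_primitive_def by (intro negligible_Un) auto
  then show "negligible {t \<in> S. \<not> ((\<lambda>t. (\<xi> t, \<zeta> t)) has_vector_derivative (g t, h t)) (at t)}"
    by (rule negligible_subset) (auto intro: has_vector_derivative_Pair)
qed

lemma ae_primitive_add:
  assumes "ae_primitive S g \<xi>" "ae_primitive S h \<zeta>"
  shows "ae_primitive S (\<lambda>t. g t + h t) (\<lambda>t. \<xi> t + \<zeta> t)"
  using ae_primitive_bounded_linear[OF ae_primitive_Pair[OF assms], of "\<lambda>p. fst p + snd p"]
  by (simp add: bounded_linear_add bounded_linear_fst bounded_linear_snd)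

lemma ae_primitive_diff:
  assumes "ae_primitive S g \<xi>" "ae_primitive S h \<zeta>"
  shows "ae_primitive S (\<lambda>t. g t - h t) (\<lambda>t. \<xi> t - \<zeta> t)"
  using ae_primitive_bounded_linear[OF ae_primitive_Pair[OF assms], of "\<lambda>p. fst p - snd p"]
  by (simp add: bounded_linear_sub bounded_linear_fst bounded_linear_snd)

text \<open>
  The integrating factor for linear equations: with \<open>g = - k \<xi> + v\<close> the new velocity is
  \<open>exp (k t) v\<close>.
\<close>
lemma ae_primitive_exp_scaleR:
  assumes "ae_primitive S g \<xi>"
  shows "ae_primitive S (\<lambda>t. exp (k * t) *\<^sub>R (g t + k *\<^sub>R \<xi> t)) (\<lambda>t. exp (k * t) *\<^sub>R \<xi> t)"
  unfolding ae_primitive_def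
proof (intro conjI allI impI)
  fix c d assume cd: "{c..d} \<subseteq> S"
  then obtain L where L: "L-lipschitz_on {c..d} \<xi>" using assms unfolding ae_primitive_def by blast
  have "compact (\<xi> ` {c..d})"
    using ae_primitive_continuous_on[OF assms cd] by (intro compact_continuous_image) auto
  then obtain B where B: "B > 0" "\<And>t. t \<in> {c..d} \<Longrightarrow> norm (\<xi> t) \<le> B"
    using compact_imp_bounded bounded_pos by (metis imageI)
  have "compact ((\<lambda>t. exp (k * t)) ` {c..d})"
    by (intro compact_continuous_image continuous_intros) auto
  then obtain P where P: "P > 0" "\<And>t. t \<in> {c..d} \<Longrightarrow> norm (exp (k * t)) \<le> P"
    using compact_imp_bounded bounded_pos by (metis imageI)
  have e: "norm (exp (k * s) - exp (k * t)) \<le> (\<bar>k\<bar> * P) * norm (s - t)" if "s \<in> {c..d}" "t \<in> {c..d}" for s t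
  proof (rule field_differentiable_bound[of "{c..d}" "\<lambda>t. exp (k * t)" "\<lambda>t. k * exp (k * t)"])
    show "((\<lambda>t. exp (k * t)) has_field_derivative k * exp (k * t)) (at t within {c..d})" for t
      by (auto intro!: derivative_eq_intros)
    show "norm (k * exp (k * t)) \<le> \<bar>k\<bar> * P" if "t \<in> {c..d}" for t
      using P(2)[OF that] by (simp add: abs_mult mult_left_mono)
  qed (use that in auto)
  have "(P * L + \<bar>k\<bar> * P * B)-lipschitz_on {c..d} (\<lambda>t. exp (k * t) *\<^sub>R \<xi> t)"
  proof (rule lipschitz_onI)
    fix s t assume st: "s \<in> {c..d}" "t \<in> {c..d}"
    have "exp (k * s) *\<^sub>R \<xi> s - exp (k * t) *\<^sub>R \<xi> t =
        exp (k * s) *\<^sub>R (\<xi> s - \<xi> t) + (exp (k * s) - exp (k * t)) *\<^sub>R \<xi> t"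
      by (simp add: algebra_simps)
    also have "norm \<dots> \<le> norm (exp (k * s)) * norm (\<xi> s - \<xi> t) + norm (exp (k * s) - exp (k * t)) * norm (\<xi> t)"
      by (rule order_trans[OF norm_triangle_ineq]) simp
    also have "\<dots> \<le> P * (L * norm (s - t)) + (\<bar>k\<bar> * P * norm (s - t)) * B"
      using P(2)[OF st(1)] e[OF st] B(2)[OF st(2)] lipschitz_onD[OF L st] P(1) B(1)
      by (intro add_mono mult_mono) (auto simp: dist_norm)
    finally show "dist (exp (k * s) *\<^sub>R \<xi> s) (exp (k * t) *\<^sub>R \<xi> t) \<le> (P * L + \<bar>k\<bar> * P * B) * dist s t"
      by (simp add: dist_norm algebra_simps)
  qed (use P B lipschitz_on_nonneg[OF L] in simp)
  then show "\<exists>L. L-lipschitz_on {c..d} (\<lambda>t. exp (k * t) *\<^sub>R \<xi> t)" by blast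
next
  have "((\<lambda>t. exp (k * t) *\<^sub>R \<xi> t) has_vector_derivative exp (k * t) *\<^sub>R (g t + k *\<^sub>R \<xi> t)) (at t)"
    if "(\<xi> has_vector_derivative g t) (at t)" for t
    by (rule derivative_eq_intros that refl)+ (simp add: algebra_simps)
  then show "negligible {t \<in> S. \<not> ((\<lambda>t. exp (k * t) *\<^sub>R \<xi> t) has_vector_derivative
       exp (k * t) *\<^sub>R (g t + k *\<^sub>R \<xi> t)) (at t)}"
    using assms unfolding ae_primitive_def by (auto elim!: negligible_subset)
qed

text \<open>
  The systems are autonomous; this is used to restart the estimate of the subsystem at a later time.
\<close>
lemma ae_primitive_shift:
  assumes \<xi>: "ae_primitive S g \<xi>" and T: "\<And>t. t \<in> T \<Longrightarrow> t + \<tau> \<in> S"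
  shows "ae_primitive T (\<lambda>t. g (t + \<tau>)) (\<lambda>t. \<xi> (t + \<tau>))"
  unfolding ae_primitive_def
proof (intro conjI allI impI)
  fix c d assume "{c..d} \<subseteq> T"
  then have "{c + \<tau>..d + \<tau>} \<subseteq> S" using T by (force dest: subsetD[where c="_ - \<tau>"])
  then obtain L where L: "L-lipschitz_on {c + \<tau>..d + \<tau>} \<xi>" using \<xi> unfolding ae_primitive_def by blast
  have "L-lipschitz_on {c..d} (\<lambda>t. \<xi> (t + \<tau>))"
  proof (rule lipschitz_onI)
    fix s t assume "s \<in> {c..d}" "t \<in> {c..d}"
    then show "dist (\<xi> (s + \<tau>)) (\<xi> (t + \<tau>)) \<le> L * dist s t"
      using lipschitz_onD[OF L, of "s + \<tau>" "t + \<tau>"] by (simp add: dist_norm)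
  qed (rule lipschitz_on_nonneg[OF L])
  then show "\<exists>L. L-lipschitz_on {c..d} (\<lambda>t. \<xi> (t + \<tau>))" by blast
next
  let ?N = "{t \<in> S. \<not> (\<xi> has_vector_derivative g t) (at t)}"
  have der: "((\<lambda>t. \<xi> (t + \<tau>)) has_vector_derivative g (t + \<tau>)) (at t)"
    if "(\<xi> has_vector_derivative g (t + \<tau>)) (at (t + \<tau>))" for t
  proof -
    have "((\<lambda>t. t + \<tau>) has_vector_derivative 1) (at t)"
      by (auto intro!: derivative_eq_intros simp flip: has_real_derivative_iff_has_vector_derivative)
    from vector_diff_chain_at[OF this that] show ?thesis by (simp add: o_def)
  qed
  have "negligible ((+) (-\<tau>) ` ?N)"
    using \<xi> unfolding ae_primitive_def by (intro negligible_translation) blast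
  moreover have "{t \<in> T. \<not> ((\<lambda>t. \<xi> (t + \<tau>)) has_vector_derivative g (t + \<tau>)) (at t)} \<subseteq> (+) (-\<tau>) ` ?N"
  proof
    fix t assume "t \<in> {t \<in> T. \<not> ((\<lambda>t. \<xi> (t + \<tau>)) has_vector_derivative g (t + \<tau>)) (at t)}"
    then have "t + \<tau> \<in> ?N" using T der by blast
    then show "t \<in> (+) (-\<tau>) ` ?N" by (rule rev_image_eqI) simp
  qed
  ultimately show "negligible {t \<in> T. \<not> ((\<lambda>t. \<xi> (t + \<tau>)) has_vector_derivative g (t + \<tau>)) (at t)}"
    by (rule negligible_subset)
qed

lemma admissible_input_integrable_on:
  assumes \<upsilon>: "admissible_input U a b \<upsilon>" and cd: "{c..d} \<subseteq> einterval a b"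
  shows "\<upsilon> integrable_on {c..d}"
proof -
  obtain C where C: "AE t in lebesgue_on {c..d}. norm (\<upsilon> t) \<le> C"
    using \<upsilon> cd unfolding admissible_input_def by (meson compact_Icc)
  have m[measurable]: "\<upsilon> \<in> borel_measurable (lebesgue_on {c..d})"
    using \<upsilon> cd unfolding admissible_input_def by (auto intro: measurable_restrict_mono)
  \<comment> \<open>Cutting off on a null set turns the essential bound into a bound.\<close>
  define h where "h t = (if norm (\<upsilon> t) \<le> C then \<upsilon> t else 0)" for t
  have "h \<in> borel_measurable (lebesgue_on {c..d})" unfolding h_def by measurable
  then have "h integrable_on {c..d}"
    by (rule measurable_bounded_by_integrable_imp_integrable[where g = "\<lambda>_. \<bar>C\<bar>"]) (auto simp: h_def)
  moreover have "negligible {t \<in> {c..d}. \<not> norm (\<upsilon> t) \<le> C}"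
    using C by (subst (asm) AE_lebesgue_on_iff_negligible) auto
  ultimately show ?thesis
    by (rule integrable_spike) (auto simp: h_def)
qed

text \<open>
  The primitive is the integral from \<open>0\<close>, taken with orientation because times on both sides of \<open>0\<close>
  matter.  An essential bound of the input is a local Lipschitz constant, and differentiability
  almost everywhere is a local property, so Lebesgue's theorem on short intervals gives it.
\<close>
lemma admissible_input_primitive_exists:
  fixes \<upsilon> :: "real \<Rightarrow> 'u::euclidean_space"
  assumes \<upsilon>: "admissible_input U a b \<upsilon>" and 0: "0 \<in> einterval a b"
  obtains G where "ae_primitive (einterval a b) \<upsilon> G" "G 0 = 0"
proof -
  define S where "S = einterval a b"
  have conv: "{s..t} \<subseteq> S" if "s \<in> S" "t \<in> S" for s t
    using that by (auto simp: S_def einterval_iff) (meson ereal_less_eq(3) less_le_trans le_less_trans)+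
  have int: "\<upsilon> integrable_on {s..t}" if "s \<in> S" "t \<in> S" for s t
    using admissible_input_integrable_on[OF \<upsilon>, of s t] conv[OF that] by (simp add: S_def)
  define G where "G t = integral {0..t} \<upsilon> - integral {t..0} \<upsilon>" for t
  have diff: "G t - G s = integral {s..t} \<upsilon>" if "s \<le> t" "s \<in> S" "t \<in> S" for s t
  proof -
    have 0: "0 \<in> S" using 0 by (simp add: S_def)
    have z: "integral {u..w} \<upsilon> = 0" if "w \<le> u" for u w
      using that by (cases "u = w") auto
    consider "0 \<le> s" | "s \<le> 0" "0 \<le> t" | "t \<le> 0" by linarith
    then show ?thesis
    proof cases
      case 1
      then show ?thesis using Henstock_Kurzweil_Integration.integral_combine[of 0 s t \<upsilon>] int[of 0 t] 0 that
        by (simp add: G_def z) (metis add_diff_cancel_left')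
    next
      case 2
      then show ?thesis using Henstock_Kurzweil_Integration.integral_combine[of s 0 t \<upsilon>] int[of s t] that
        by (simp add: G_def z add.commute)
    next
      case 3
      then show ?thesis using Henstock_Kurzweil_Integration.integral_combine[of s t 0 \<upsilon>] int[of s 0] 0 that
        by (simp add: G_def z algebra_simps)
    qed
  qed
  have "ae_primitive S \<upsilon> G"
    unfolding ae_primitive_def
  proof (intro conjI allI impI)
    fix c d assume cd: "{c..d} \<subseteq> S"
    then obtain C where C: "AE t in lebesgue_on {c..d}. norm (\<upsilon> t) \<le> C"
      using \<upsilon> unfolding admissible_input_def S_def by (meson compact_Icc)
    have N: "negligible {t \<in> {c..d}. \<not> norm (\<upsilon> t) \<le> C}"
      using C by (subst (asm) AE_lebesgue_on_iff_negligible) auto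
    have "\<bar>C\<bar>-lipschitz_on {c..d} G"
    proof (rule lipschitz_on_leI)
      fix s t assume st: "s \<in> {c..d}" "t \<in> {c..d}" "s \<le> t"
      then have "s \<in> S" "t \<in> S" using cd by auto
      have "norm (integral {s..t} \<upsilon>) \<le> \<bar>C\<bar> * (t - s)"
      proof (rule has_integral_norm_bound_ae[OF _ _ N])
        show "(\<upsilon> has_integral integral {s..t} \<upsilon>) {s..t}"
          using int[OF \<open>s \<in> S\<close> \<open>t \<in> S\<close>] by (rule integrable_integral)
        show "((\<lambda>_. \<bar>C\<bar>) has_integral \<bar>C\<bar> * (t - s)) {s..t}"
          using has_integral_const_real[of "\<bar>C\<bar>" s t] st by (simp add: mult.commute)
      qed (use st in auto)
      then show "dist (G s) (G t) \<le> \<bar>C\<bar> * dist s t"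
        using diff[OF st(3) \<open>s \<in> S\<close> \<open>t \<in> S\<close>] st(3)
        by (simp add: dist_norm norm_minus_commute[of "G s"])
    qed simp
    then show "\<exists>L. L-lipschitz_on {c..d} G" by blast
  next
    let ?E = "{t \<in> S. \<not> (G has_vector_derivative \<upsilon> t) (at t)}"
    show "negligible ?E"
      unfolding locally_negligible_alt[of ?E]
    proof
      fix t assume "t \<in> ?E"
      then have "t \<in> S" by blast
      then obtain e where e: "e > 0" "cball t e \<subseteq> S"
        using open_contains_cball[of S] by (auto simp: S_def)
      define c where "c = t - e"
      define d where "d = t + e"
      have cd: "{c..d} \<subseteq> S" "c < t" "t < d" using e by (auto simp: c_def d_def cball_eq_atLeastAtMost)
      then have "c \<in> S" "d \<in> S" by auto
      obtain N where N: "negligible N"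
        "\<And>s. s \<in> {c<..<d} - N \<Longrightarrow> ((\<lambda>u. integral {c..u} \<upsilon>) has_vector_derivative \<upsilon> s) (at s)"
        using integral_has_vector_derivative_ae[OF int[OF \<open>c \<in> S\<close> \<open>d \<in> S\<close>]] by blast
      have "(G has_vector_derivative \<upsilon> s) (at s)" if s: "s \<in> {c<..<d} - N" for s
      proof (rule has_vector_derivative_transform_within_open)
        show "((\<lambda>u. integral {c..u} \<upsilon> + G c) has_vector_derivative \<upsilon> s) (at s)"
          using N(2)[OF s] by (auto intro!: derivative_eq_intros)
        show "integral {c..u} \<upsilon> + G c = G u" if "u \<in> {c<..<d}" for u
        proof -
          have "u \<in> S" using that cd(1) by auto
          then have "integral {c..u} \<upsilon> = G u - G c" using diff[of c u] that \<open>c \<in> S\<close> by simp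
          then show ?thesis by simp
        qed
      qed (use s in auto)
      then have "?E \<inter> {c<..<d} \<subseteq> N" by blast
      then have "negligible (?E \<inter> {c<..<d})" using N(1) by (rule negligible_subset[rotated])
      moreover have "openin (top_of_set ?E) (?E \<inter> {c<..<d})" by (intro openin_open_Int) simp
      ultimately show "\<exists>U. openin (top_of_set ?E) U \<and> t \<in> U \<and> negligible U"
        using \<open>t \<in> ?E\<close> cd by (intro exI[of _ "?E \<inter> {c<..<d}"]) auto
    qed
  qed
  moreover have "G 0 = 0" by (simp add: G_def)
  ultimately show ?thesis using that by (simp add: S_def)
qed

section \<open>Trajectories as locally Lipschitz curves\<close>

lemma continuous_imp_admissible_input:
  assumes "continuous_on (einterval a b) \<upsilon>"
  shows "admissible_input UNIV a b \<upsilon>"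
  unfolding admissible_input_def
proof (intro conjI allI impI ballI)
  show "\<upsilon> \<in> borel_measurable (lebesgue_on (einterval a b))"
    using assms by (intro continuous_imp_measurable_on_sets_lebesgue) auto
  fix K :: "real set" assume K: "compact K \<and> K \<subseteq> einterval a b"
  then have "bounded (\<upsilon> ` K)"
    using assms by (meson compact_continuous_image compact_imp_bounded continuous_on_subset)
  then obtain C where "\<And>t. t \<in> K \<Longrightarrow> norm (\<upsilon> t) \<le> C" unfolding bounded_iff by blast
  then show "\<exists>C. AE t in lebesgue_on K. norm (\<upsilon> t) \<le> C"
    by (intro exI[of _ C] AE_I2) (simp add: space_restrict_space)
qed simp

lemma admissible_input_subset:
  assumes "admissible_input U a b \<upsilon>" "einterval a' b' \<subseteq> einterval a b"
  shows "admissible_input U a' b' \<upsilon>"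
  using assms unfolding admissible_input_def
  by (meson measurable_restrict_mono order_trans subsetD)

text \<open>
  On a compact interval \<open>\<xi>\<close> stays in a compact set and the input is essentially bounded, so
  continuity of \<open>F\<close> bounds the velocity almost everywhere, say by \<open>L\<close>.  By absolute continuity \<open>\<xi>\<close>
  is the integral of its velocity, hence \<open>L\<close>-Lipschitz.
\<close>
lemma trajectory_imp_ae_primitive:
  fixes F :: "'x::euclidean_space \<Rightarrow> 'u::euclidean_space \<Rightarrow> 'x"
  assumes F: "continuous_on (UNIV \<times> UNIV) (\<lambda>(x, u). F x u)" and tr: "trajectory U F a b \<upsilon> \<xi>"
  shows "ae_primitive (einterval a b) (\<lambda>t. F (\<xi> t) (\<upsilon> t)) \<xi>"
proof -
  define S where "S = einterval a b"
  have adm: "admissible_input U a b \<upsilon>"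
    and ac: "\<And>c d. {c..d} \<subseteq> S \<Longrightarrow> absolutely_continuous_between c d \<xi>"
    and N: "negligible {t \<in> S. \<not> (\<xi> has_vector_derivative F (\<xi> t) (\<upsilon> t)) (at t)}"
    using tr unfolding trajectory_def S_def by (auto simp: AE_lebesgue_on_iff_negligible)
  have "\<exists>L. L-lipschitz_on {c..d} \<xi>" if cd: "{c..d} \<subseteq> S" for c d
  proof -
    obtain C where C: "AE t in lebesgue_on {c..d}. norm (\<upsilon> t) \<le> C"
      using adm cd unfolding admissible_input_def S_def by (meson compact_Icc)
    have N2: "negligible {t \<in> {c..d}. \<not> norm (\<upsilon> t) \<le> C}"
      using C by (subst (asm) AE_lebesgue_on_iff_negligible) auto
    have "continuous_on {c..d} \<xi>" using ac[OF cd] by (rule absolutely_continuous_imp_continuous_on)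
    then have "compact ((\<xi> ` {c..d}) \<times> (cball 0 C :: 'u set))"
      by (intro compact_Times compact_continuous_image) auto
    then have "bounded ((\<lambda>(x, u). F x u) ` ((\<xi> ` {c..d}) \<times> cball 0 C))"
      using F by (intro compact_imp_bounded compact_continuous_image) (auto intro: continuous_on_subset)
    then obtain L where "\<forall>y\<in>(\<lambda>(x, u). F x u) ` ((\<xi> ` {c..d}) \<times> cball 0 C). norm y \<le> L"
      unfolding bounded_iff by blast
    then have L: "norm (F (\<xi> t) (\<upsilon> t)) \<le> \<bar>L\<bar>" if "t \<in> {c..d}" "norm (\<upsilon> t) \<le> C" for t
      using that by force
    have "\<bar>L\<bar>-lipschitz_on {c..d} \<xi>"
    proof (rule lipschitz_on_leI)
      fix s t assume st: "s \<in> {c..d}" "t \<in> {c..d}" "s \<le> t"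
      then have sub: "{s..t} \<subseteq> {c..d}" by auto
      have "norm (\<xi> t - \<xi> s) \<le> \<bar>L\<bar> * (t - s)"
      proof (rule has_integral_norm_bound_ae[OF _ _ N2])
        show "((\<lambda>t. F (\<xi> t) (\<upsilon> t)) has_integral \<xi> t - \<xi> s) {s..t}"
        proof (rule has_integral_derivative_of_absolutely_continuous[OF st(3) _ N])
          show "absolutely_continuous_between s t \<xi>" using sub cd by (intro ac) auto
          fix u assume u: "u \<in> {s..t} - {t \<in> S. \<not> (\<xi> has_vector_derivative F (\<xi> t) (\<upsilon> t)) (at t)}"
          then have "u \<in> S" using sub cd by auto
          then show "(\<xi> has_vector_derivative F (\<xi> u) (\<upsilon> u)) (at u within {s..t})"
            using u by (auto intro: has_vector_derivative_at_within)
        qed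
        show "((\<lambda>_. \<bar>L\<bar>) has_integral \<bar>L\<bar> * (t - s)) {s..t}"
          using has_integral_const_real[of "\<bar>L\<bar>" s t] st by (simp add: mult.commute)
      qed (use L sub in auto)
      then show "dist (\<xi> s) (\<xi> t) \<le> \<bar>L\<bar> * dist s t"
        using st(3) by (simp add: dist_norm norm_minus_commute[of "\<xi> s"])
    qed simp
    then show ?thesis by blast
  qed
  with N show ?thesis unfolding ae_primitive_def S_def by blast
qed

lemma trajectory_iff_ae_primitive:
  fixes F :: "'x::euclidean_space \<Rightarrow> 'u::euclidean_space \<Rightarrow> 'x"
  assumes F: "continuous_on (UNIV \<times> UNIV) (\<lambda>(x, u). F x u)"
  shows "trajectory U F a b \<upsilon> \<xi> \<longleftrightarrow>
    admissible_input U a b \<upsilon> \<and> ae_primitive (einterval a b) (\<lambda>t. F (\<xi> t) (\<upsilon> t)) \<xi>"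
proof (intro iffI conjI)
  assume "trajectory U F a b \<upsilon> \<xi>"
  then show "admissible_input U a b \<upsilon>" "ae_primitive (einterval a b) (\<lambda>t. F (\<xi> t) (\<upsilon> t)) \<xi>"
    using trajectory_imp_ae_primitive[OF F] by (auto simp: trajectory_def)
next
  assume "admissible_input U a b \<upsilon> \<and> ae_primitive (einterval a b) (\<lambda>t. F (\<xi> t) (\<upsilon> t)) \<xi>"
  then show "trajectory U F a b \<upsilon> \<xi>"
    unfolding trajectory_def ae_primitive_def
    by (simp add: AE_lebesgue_on_iff_negligible) (meson lipschitz_on_imp_absolutely_continuous)
qed

section \<open>The linear equation of the tracking error\<close>

text \<open>
  Variation of constants: \<open>exp (c t) z\<close> has velocity \<open>exp (c t) v\<close>, whose norm integrates to at most
  \<open>V exp (c t) / c\<close>.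
\<close>
lemma ae_primitive_linear_decay:
  fixes z v :: "real \<Rightarrow> 'x::euclidean_space"
  assumes z: "ae_primitive S (\<lambda>t. - c *\<^sub>R z t + v t) z" and st: "{s..t} \<subseteq> S" "s \<le> t"
    and c: "c > 0" and N: "negligible N" and v: "\<And>u. u \<in> {s..t} - N \<Longrightarrow> norm (v u) \<le> V"
    and V: "V \<ge> 0"
  shows "norm (z t) \<le> exp (- c * (t - s)) * norm (z s) + V / c"
proof -
  have "ae_primitive S (\<lambda>t. exp (c * t) *\<^sub>R v t) (\<lambda>t. exp (c * t) *\<^sub>R z t)"
    using ae_primitive_exp_scaleR[OF z, of c] by simp
  then have 1: "((\<lambda>t. exp (c * t) *\<^sub>R v t) has_integral exp (c * t) *\<^sub>R z t - exp (c * s) *\<^sub>R z s) {s..t}"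
    by (rule ae_primitive_has_integral) fact+
  have 2: "((\<lambda>u. V * exp (c * u)) has_integral V * exp (c * t) / c - V * exp (c * s) / c) {s..t}"
    using c by (intro fundamental_theorem_of_calculus[OF st(2)])
      (auto intro!: derivative_eq_intros simp flip: has_real_derivative_iff_has_vector_derivative)
  have "norm (exp (c * t) *\<^sub>R z t - exp (c * s) *\<^sub>R z s) \<le> V * exp (c * t) / c - V * exp (c * s) / c"
    by (rule has_integral_norm_bound_ae[OF 1 2 N]) (use v in \<open>auto simp: mult_right_mono\<close>)
  also have "\<dots> \<le> V * exp (c * t) / c" using V c by simp
  finally have "norm (exp (c * t) *\<^sub>R z t) \<le> norm (exp (c * s) *\<^sub>R z s) + V * exp (c * t) / c"
    using norm_triangle_ineq2[of "exp (c * t) *\<^sub>R z t" "exp (c * s) *\<^sub>R z s"] by linarith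
  then have "exp (c * t) * norm (z t) \<le> exp (c * s) * norm (z s) + V * exp (c * t) / c" by simp
  also have "\<dots> = exp (c * t) * (exp (- c * (t - s)) * norm (z s) + V / c)"
  proof -
    have "exp (c * s) = exp (c * t) * exp (- c * (t - s))" by (simp flip: exp_add add: algebra_simps)
    then show ?thesis by (simp add: algebra_simps)
  qed
  finally show ?thesis by simp
qed

text \<open>
  The extension is given by the variation of constants formula
  \<open>z' t = exp (- c t) (z 0 + G t)\<close>, where \<open>G\<close> is the primitive of \<open>exp (c t) v\<close> that vanishes at \<open>0\<close>.
  It agrees with \<open>z\<close> because \<open>exp (c t) z\<close> and \<open>G\<close> have the same velocity almost everywhere.
\<close>
lemma ae_primitive_linear_extension:
  fixes z v :: "real \<Rightarrow> 'x::euclidean_space"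
  assumes v: "admissible_input U a \<infinity> v" and a: "a < 0" and b: "0 < b"
    and z: "ae_primitive (einterval a b) (\<lambda>t. - c *\<^sub>R z t + v t) z"
  obtains z' where "ae_primitive (einterval a \<infinity>) (\<lambda>t. - c *\<^sub>R z' t + v t) z'"
    "\<And>t. t \<in> einterval a b \<Longrightarrow> z' t = z t"
proof -
  define w where "w t = exp (c * t) *\<^sub>R v t" for t
  have "admissible_input UNIV a \<infinity> w"
    unfolding admissible_input_def
  proof (intro conjI allI impI ballI)
    have "v \<in> borel_measurable (lebesgue_on (einterval a \<infinity>))" using v unfolding admissible_input_def by blast
    moreover have "(\<lambda>t. exp (c * t)) \<in> borel_measurable (lebesgue_on (einterval a \<infinity>))"
      by (intro continuous_imp_measurable_on_sets_lebesgue continuous_intros) auto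
    ultimately show "w \<in> borel_measurable (lebesgue_on (einterval a \<infinity>))"
      unfolding w_def by measurable
    fix K :: "real set" assume K: "compact K \<and> K \<subseteq> einterval a \<infinity>"
    then obtain C where C: "AE t in lebesgue_on K. norm (v t) \<le> C" using v unfolding admissible_input_def by meson
    have "bounded ((\<lambda>t. exp (c * t)) ` K)"
      using K by (intro compact_imp_bounded compact_continuous_image continuous_intros) auto
    then obtain P where P: "\<And>t. t \<in> K \<Longrightarrow> exp (c * t) \<le> P" unfolding bounded_iff by force
    have "AE t in lebesgue_on K. t \<in> K" by (rule AE_I2) (simp add: space_restrict_space)
    with C have "AE t in lebesgue_on K. norm (w t) \<le> P * C"
    proof eventually_elim
      case (elim t)
      moreover have "0 \<le> P" using P[OF elim(2)] by (meson exp_ge_zero order_trans)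
      ultimately show ?case using P[OF elim(2)] by (auto simp: w_def intro!: mult_mono)
    qed
    then show "\<exists>C. AE t in lebesgue_on K. norm (w t) \<le> C" by blast
  qed simp
  then obtain G where G: "ae_primitive (einterval a \<infinity>) w G" "G 0 = 0"
    by (rule admissible_input_primitive_exists) (use a in \<open>auto simp: einterval_iff zero_ereal_def\<close>)
  define z' where "z' t = exp (- c * t) *\<^sub>R (G t + z 0)" for t
  have "ae_primitive (einterval a \<infinity>) (\<lambda>_. 0) (\<lambda>_. z 0)"
    by (auto simp: ae_primitive_def intro: lipschitz_on_constant)
  from ae_primitive_add[OF G(1) this] have "ae_primitive (einterval a \<infinity>) w (\<lambda>t. G t + z 0)" by simp
  from ae_primitive_exp_scaleR[OF this, of "-c"]
  have "ae_primitive (einterval a \<infinity>) (\<lambda>t. exp (- c * t) *\<^sub>R (w t + (- c) *\<^sub>R (G t + z 0))) z'"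
    by (simp add: z'_def[abs_def])
  moreover have "exp (- c * t) *\<^sub>R (w t + (- c) *\<^sub>R (G t + z 0)) = - c *\<^sub>R z' t + v t" for t
    by (simp add: w_def z'_def algebra_simps flip: exp_add)
  ultimately have 1: "ae_primitive (einterval a \<infinity>) (\<lambda>t. - c *\<^sub>R z' t + v t) z'" by simp
  have "z' t = z t" if t: "t \<in> einterval a b" for t
  proof -
    have ez: "ae_primitive (einterval a b) w (\<lambda>t. exp (c * t) *\<^sub>R z t)"
      using ae_primitive_exp_scaleR[OF z, of c] by (simp add: w_def[abs_def])
    have eG: "ae_primitive (einterval a b) w G"
      by (rule ae_primitive_subset[OF G(1)]) (auto simp: einterval_iff)
    have eq: "exp (c * r) *\<^sub>R z r - exp (c * s) *\<^sub>R z s = G r - G s"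
      if "s \<le> r" "{s..r} \<subseteq> einterval a b" for s r
      using ae_primitive_has_integral[OF ez that(2,1)] ae_primitive_has_integral[OF eG that(2,1)]
      by (rule has_integral_unique)
    have sub: "{0..t} \<subseteq> einterval a b" "{t..0} \<subseteq> einterval a b"
      using t a b by (auto simp: einterval_iff zero_ereal_def)
        (meson ereal_less_eq(3) less_le_trans le_less_trans)+
    have "exp (c * t) *\<^sub>R z t - z 0 = G t"
      using eq[of 0 t] eq[of t 0] sub G(2) by (cases "0 \<le> t") (auto simp: algebra_simps)
    then have "G t + z 0 = exp (c * t) *\<^sub>R z t" by (simp add: algebra_simps)
    then show ?thesis by (simp add: z'_def flip: exp_add)
  qed
  with 1 that show ?thesis by blast
qed

section \<open>The closed loop as a cascade\<close>

lemma continuously_differentiable_has_derivative: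
  "continuously_differentiable \<psi> \<Longrightarrow> (\<psi> has_derivative (\<lambda>h. jacobian \<psi> (at y) *v h)) (at y)"
  unfolding continuously_differentiable_def by (simp add: jacobian_works)

lemma continuously_differentiable_lipschitz_on_cball:
  fixes \<psi> :: "real^'n \<Rightarrow> real^'m"
  assumes \<psi>: "continuously_differentiable \<psi>"
  shows "\<exists>L. L-lipschitz_on (cball 0 R) \<psi>"
proof -
  define B where "B y = (\<Sum>i\<in>UNIV. \<Sum>j\<in>UNIV. \<bar>jacobian \<psi> (at y) $ i $ j\<bar>)" for y
  have "continuous_on (cball 0 R) (\<lambda>y. jacobian \<psi> (at y))"
    using \<psi> unfolding continuously_differentiable_def by (auto intro: continuous_on_subset)
  then have "continuous_on (cball 0 R) B"
    unfolding B_def by (intro continuous_intros)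
  then have "bounded (B ` cball 0 R)"
    by (intro compact_imp_bounded compact_continuous_image) auto
  then obtain L where "\<forall>x\<in>B ` cball 0 R. norm x \<le> L" unfolding bounded_iff by blast
  then have L: "B y \<le> \<bar>L\<bar>" if "y \<in> cball 0 R" for y using that by force
  have "\<bar>L\<bar>-lipschitz_on (cball 0 R) \<psi>"
  proof (rule bounded_derivative_imp_lipschitz)
    show "(\<psi> has_derivative (\<lambda>h. jacobian \<psi> (at y) *v h)) (at y within cball 0 R)" for y
      using continuously_differentiable_has_derivative[OF \<psi>] by (rule has_derivative_at_withinI)
    show "onorm (\<lambda>h. jacobian \<psi> (at y) *v h) \<le> \<bar>L\<bar>" if "y \<in> cball 0 R" for y
      using onorm_le_matrix_component_sum[of "jacobian \<psi> (at y)"] L[OF that] by (simp add: B_def)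
  qed auto
  then show ?thesis by blast
qed

lemma ae_primitive_compose_continuously_differentiable:
  fixes \<psi> :: "real^'n \<Rightarrow> real^'m"
  assumes "continuously_differentiable \<psi>" "ae_primitive S g \<eta>"
  shows "ae_primitive S (\<lambda>t. jacobian \<psi> (at (\<eta> t)) *v g t) (\<lambda>t. \<psi> (\<eta> t))"
  using ae_primitive_compose[OF assms(2) continuously_differentiable_lipschitz_on_cball[OF assms(1)]
      continuously_differentiable_has_derivative[OF assms(1)]] .

lemma closed_loop_eq:
  "closed_loop (integrator_system f) (backstepping_feedback c \<psi> f) (\<eta>, \<zeta>) v =
    (f \<eta> \<zeta>, - c *\<^sub>R (\<zeta> - \<psi> \<eta>) + jacobian \<psi> (at \<eta>) *v f \<eta> \<zeta> + v)"
  by (simp add: closed_loop_def integrator_system_def backstepping_feedback_def)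

lemma continuous_on_matrix_vector_mult:
  fixes A :: "'a::topological_space \<Rightarrow> real^'n^'m"
  assumes "continuous_on S A" "continuous_on S x"
  shows "continuous_on S (\<lambda>s. A s *v x s)"
  unfolding matrix_vector_mult_def using assms by (intro continuous_intros)

lemma closed_loop_continuous:
  fixes f :: "real^'n \<Rightarrow> real^'m \<Rightarrow> real^'n"
  assumes f: "continuous_on UNIV (\<lambda>(\<eta>, \<zeta>). f \<eta> \<zeta>)" and \<psi>: "continuously_differentiable \<psi>"
  shows "continuous_on (UNIV \<times> UNIV)
    (\<lambda>(x, v). closed_loop (integrator_system f) (backstepping_feedback c \<psi> f) x v)"
proof -
  have c\<psi>: "continuous_on UNIV \<psi>"
    using continuously_differentiable_has_derivative[OF \<psi>]
    by (meson continuous_at_imp_continuous_on has_derivative_continuous)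
  have cJ: "continuous_on UNIV (\<lambda>y. jacobian \<psi> (at y))"
    using \<psi> unfolding continuously_differentiable_def by blast
  have 1: "continuous_on UNIV (\<lambda>p :: ((real^'n) \<times> (real^'m)) \<times> (real^'m). f (fst (fst p)) (snd (fst p)))"
    using continuous_on_compose2[OF f, of UNIV fst]
    by (simp add: split_def continuous_on_fst)
  have 2: "continuous_on UNIV (\<lambda>p :: ((real^'n) \<times> (real^'m)) \<times> (real^'m). \<psi> (fst (fst p)))"
    by (rule continuous_on_compose2[OF c\<psi>]) (auto intro!: continuous_intros)
  have 3: "continuous_on UNIV (\<lambda>p :: ((real^'n) \<times> (real^'m)) \<times> (real^'m). jacobian \<psi> (at (fst (fst p))))"
    by (rule continuous_on_compose2[OF cJ]) (auto intro!: continuous_intros)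
  have "continuous_on UNIV (\<lambda>p :: ((real^'n) \<times> (real^'m)) \<times> (real^'m).
      (f (fst (fst p)) (snd (fst p)), - c *\<^sub>R (snd (fst p) - \<psi> (fst (fst p))) +
        jacobian \<psi> (at (fst (fst p))) *v f (fst (fst p)) (snd (fst p)) + snd p))"
    by (intro continuous_intros continuous_on_matrix_vector_mult 1 2 3)
  then show ?thesis by (simp add: split_def closed_loop_eq[of f c \<psi> "fst x" "snd x" for x, simplified])
qed

lemma continuous_on_control_system:
  "control_system U F \<Longrightarrow> continuous_on (UNIV \<times> U) (\<lambda>(x, u). F x u)"
  by (simp add: control_system_def)

lemma continuous_on_of_integrator_system:
  fixes f :: "real^'n \<Rightarrow> real^'m \<Rightarrow> real^'n"
  assumes "control_system UNIV (integrator_system f)"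
  shows "continuous_on UNIV (\<lambda>(\<eta>, \<zeta>). f \<eta> \<zeta>)"
proof -
  have "continuous_on UNIV (\<lambda>p :: ((real^'n) \<times> (real^'m)) \<times> (real^'m). (f (fst (fst p)) (snd (fst p)), snd p))"
    using continuous_on_control_system[OF assms] by (simp add: integrator_system_def split_def)
  then have "continuous_on UNIV (\<lambda>p :: ((real^'n) \<times> (real^'m)) \<times> (real^'m). f (fst (fst p)) (snd (fst p)))"
    using continuous_on_fst by fastforce
  from continuous_on_compose2[OF this, of UNIV "\<lambda>q. (q, 0)"] show ?thesis
    by (simp add: split_def continuous_on_Pair)
qed

text \<open>
  The Jacobian term of the feedback is, by the chain rule, the velocity of \<open>\<psi>(\<eta>)\<close>; it cancels
  in the velocity of \<open>z\<close>, which does not depend on \<open>\<eta>\<close> any more.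
\<close>
lemma closed_loop_trajectoryD:
  fixes f :: "real^'n \<Rightarrow> real^'m \<Rightarrow> real^'n"
  assumes f: "continuous_on UNIV (\<lambda>(\<eta>, \<zeta>). f \<eta> \<zeta>)" and \<psi>: "continuously_differentiable \<psi>"
    and cont: "continuous_on (UNIV \<times> UNIV) (\<lambda>(\<eta>, u). f \<eta> (\<psi> \<eta> + u))"
    and x: "trajectory UNIV (closed_loop (integrator_system f) (backstepping_feedback c \<psi> f)) a b v x"
  defines "z \<equiv> (\<lambda>t. snd (x t) - \<psi> (fst (x t)))"
  shows "ae_primitive (einterval a b) (\<lambda>t. - c *\<^sub>R z t + v t) z"
    and "trajectory UNIV (\<lambda>\<eta> u. f \<eta> (\<psi> \<eta> + u)) a b z (\<lambda>t. fst (x t))"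
proof -
  let ?S = "einterval a b"
  have "ae_primitive ?S (\<lambda>t. closed_loop (integrator_system f) (backstepping_feedback c \<psi> f) (x t) (v t)) x"
    using x trajectory_iff_ae_primitive[OF closed_loop_continuous[OF f \<psi>]] by blast
  then have x': "ae_primitive ?S (\<lambda>t. (f (fst (x t)) (snd (x t)), - c *\<^sub>R z t +
      jacobian \<psi> (at (fst (x t))) *v f (fst (x t)) (snd (x t)) + v t)) x"
    using closed_loop_eq[of f c \<psi> "fst (x t)" "snd (x t)" for t, simplified] by (simp add: z_def)
  have \<eta>: "ae_primitive ?S (\<lambda>t. f (fst (x t)) (snd (x t))) (\<lambda>t. fst (x t))"
    using ae_primitive_bounded_linear[OF x' bounded_linear_fst] by simp
  have \<zeta>: "ae_primitive ?S (\<lambda>t. - c *\<^sub>R z t +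
      jacobian \<psi> (at (fst (x t))) *v f (fst (x t)) (snd (x t)) + v t) (\<lambda>t. snd (x t))"
    using ae_primitive_bounded_linear[OF x' bounded_linear_snd] by simp
  show z: "ae_primitive ?S (\<lambda>t. - c *\<^sub>R z t + v t) z"
    using ae_primitive_diff[OF \<zeta> ae_primitive_compose_continuously_differentiable[OF \<psi> \<eta>]]
    by (simp add: z_def algebra_simps)
  have "admissible_input UNIV a b z"
    by (intro continuous_imp_admissible_input ae_primitive_continuous_on_open[OF z]) simp
  moreover have "\<psi> (fst (x t)) + z t = snd (x t)" for t by (simp add: z_def)
  ultimately show "trajectory UNIV (\<lambda>\<eta> u. f \<eta> (\<psi> \<eta> + u)) a b z (\<lambda>t. fst (x t))"
    using \<eta> by (simp add: trajectory_iff_ae_primitive[OF cont])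
qed

lemma closed_loop_trajectoryI:
  fixes f :: "real^'n \<Rightarrow> real^'m \<Rightarrow> real^'n"
  assumes f: "continuous_on UNIV (\<lambda>(\<eta>, \<zeta>). f \<eta> \<zeta>)" and \<psi>: "continuously_differentiable \<psi>"
    and cont: "continuous_on (UNIV \<times> UNIV) (\<lambda>(\<eta>, u). f \<eta> (\<psi> \<eta> + u))"
    and \<eta>: "trajectory UNIV (\<lambda>\<eta> u. f \<eta> (\<psi> \<eta> + u)) a b z \<eta>"
    and z: "ae_primitive (einterval a b) (\<lambda>t. - c *\<^sub>R z t + v t) z"
    and v: "admissible_input UNIV a b v"
  shows "trajectory UNIV (closed_loop (integrator_system f) (backstepping_feedback c \<psi> f)) a b v
     (\<lambda>t. (\<eta> t, \<psi> (\<eta> t) + z t))"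
proof -
  have \<eta>': "ae_primitive (einterval a b) (\<lambda>t. f (\<eta> t) (\<psi> (\<eta> t) + z t)) \<eta>"
    using \<eta> trajectory_iff_ae_primitive[OF cont] by blast
  have "ae_primitive (einterval a b) (\<lambda>t. (f (\<eta> t) (\<psi> (\<eta> t) + z t),
      jacobian \<psi> (at (\<eta> t)) *v f (\<eta> t) (\<psi> (\<eta> t) + z t) + (- c *\<^sub>R z t + v t)))
      (\<lambda>t. (\<eta> t, \<psi> (\<eta> t) + z t))"
    by (intro ae_primitive_Pair ae_primitive_add \<eta>' z
        ae_primitive_compose_continuously_differentiable[OF \<psi> \<eta>'])
  then show ?thesis
    using v by (simp add: trajectory_iff_ae_primitive[OF closed_loop_continuous[OF f \<psi>]] closed_loop_eq algebra_simps)
qed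

text \<open>
  The tracking error is extended first, since its equation is decoupled; only then is there an
  input on all of \<open>]a,\<infinity>[\<close> along which the subsystem can be extended.
\<close>
lemma closed_loop_forward_complete:
  fixes f :: "real^'n \<Rightarrow> real^'m \<Rightarrow> real^'n"
  assumes f: "continuous_on UNIV (\<lambda>(\<eta>, \<zeta>). f \<eta> \<zeta>)" and \<psi>: "continuously_differentiable \<psi>"
    and cont: "continuous_on (UNIV \<times> UNIV) (\<lambda>(\<eta>, u). f \<eta> (\<psi> \<eta> + u))"
    and fc: "forward_complete UNIV (\<lambda>\<eta> u. f \<eta> (\<psi> \<eta> + u))"
  shows "forward_complete UNIV (closed_loop (integrator_system f) (backstepping_feedback c \<psi> f))"
  unfolding forward_complete_def
proof (intro allI impI, elim conjE)
  fix a b v x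
  assume a: "a < (0::ereal)" and b: "0 < b" and v: "admissible_input UNIV a \<infinity> v"
    and x: "trajectory UNIV (closed_loop (integrator_system f) (backstepping_feedback c \<psi> f)) a b v x"
  define z where "z = (\<lambda>t. snd (x t) - \<psi> (fst (x t)))"
  have z: "ae_primitive (einterval a b) (\<lambda>t. - c *\<^sub>R z t + v t) z"
    and \<eta>: "trajectory UNIV (\<lambda>\<eta> u. f \<eta> (\<psi> \<eta> + u)) a b z (\<lambda>t. fst (x t))"
    using closed_loop_trajectoryD[OF f \<psi> cont x] by (simp_all add: z_def)
  obtain z' where z': "ae_primitive (einterval a \<infinity>) (\<lambda>t. - c *\<^sub>R z' t + v t) z'"
    and zz: "\<And>t. t \<in> einterval a b \<Longrightarrow> z' t = z t"
    using ae_primitive_linear_extension[OF v a b z] by blast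
  have adm: "admissible_input UNIV a \<infinity> z'"
    by (intro continuous_imp_admissible_input ae_primitive_continuous_on_open[OF z']) simp
  have "ae_primitive (einterval a b) (\<lambda>t. f (fst (x t)) (\<psi> (fst (x t)) + z t)) (\<lambda>t. fst (x t))"
    using \<eta> by (simp add: trajectory_iff_ae_primitive[OF cont])
  then have "ae_primitive (einterval a b) (\<lambda>t. f (fst (x t)) (\<psi> (fst (x t)) + z' t)) (\<lambda>t. fst (x t))"
    unfolding ae_primitive_def by (simp add: zz cong: conj_cong)
  then have "trajectory UNIV (\<lambda>\<eta> u. f \<eta> (\<psi> \<eta> + u)) a b z' (\<lambda>t. fst (x t))"
    using admissible_input_subset[OF adm, of a b]
    by (simp add: trajectory_iff_ae_primitive[OF cont] einterval_iff subset_iff)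
  then obtain \<eta>' where \<eta>': "trajectory UNIV (\<lambda>\<eta> u. f \<eta> (\<psi> \<eta> + u)) a \<infinity> z' \<eta>'"
    and \<eta>\<eta>: "\<And>t. t \<in> einterval a b \<Longrightarrow> \<eta>' t = fst (x t)"
    using fc a b adm unfolding forward_complete_def by blast
  show "\<exists>x'. trajectory UNIV (closed_loop (integrator_system f) (backstepping_feedback c \<psi> f)) a \<infinity> v x' \<and>
      (\<forall>t\<in>einterval a b. x' t = x t)"
    using closed_loop_trajectoryI[OF f \<psi> cont \<eta>' z' v]
    by (intro exI[of _ "\<lambda>t. (\<eta>' t, \<psi> (\<eta>' t) + z' t)"]) (auto simp: \<eta>\<eta> zz z_def)
qed

section \<open>Comparison functions\<close>

lemma class_K_strict_mono: "class_K \<gamma> \<Longrightarrow> 0 \<le> r \<Longrightarrow> r < s \<Longrightarrow> \<gamma> r < \<gamma> s"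
  unfolding class_K_def using strict_mono_onD[of "{0..}" \<gamma> r s] by auto

lemma class_K_mono: "class_K \<gamma> \<Longrightarrow> 0 \<le> r \<Longrightarrow> r \<le> s \<Longrightarrow> \<gamma> r \<le> \<gamma> s"
  using class_K_strict_mono[of \<gamma> r s] by (cases "r = s") auto

lemma class_K_nonneg: "class_K \<gamma> \<Longrightarrow> 0 \<le> r \<Longrightarrow> 0 \<le> \<gamma> r"
  using class_K_mono[of \<gamma> 0 r] by (simp add: class_K_def)

text \<open>
  The larger of \<open>a\<close> and \<open>b\<close> is at least half of the sum.  This weak triangle inequality is what
  separates the effects of the initial states from those of the inputs.
\<close>
lemma class_K_add_le:
  assumes \<gamma>: "class_K \<gamma>" and "0 \<le> a" "0 \<le> b"
  shows "\<gamma> (a + b) \<le> \<gamma> (2 * a) + \<gamma> (2 * b)"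
proof (cases "a \<le> b")
  case True
  have "\<gamma> (a + b) \<le> \<gamma> (2 * b)" by (rule class_K_mono[OF \<gamma>]) (use assms True in auto)
  then show ?thesis using class_K_nonneg[OF \<gamma>, of "2 * a"] assms by simp
next
  case False
  have "\<gamma> (a + b) \<le> \<gamma> (2 * a)" by (rule class_K_mono[OF \<gamma>]) (use assms False in auto)
  then show ?thesis using class_K_nonneg[OF \<gamma>, of "2 * b"] assms by simp
qed

lemma class_K_infD: "class_K_inf \<gamma> \<Longrightarrow> class_K \<gamma>"
  by (simp add: class_K_inf_def)

lemma class_K_inf_mult: "k > 0 \<Longrightarrow> class_K_inf (\<lambda>r. k * r)"
  unfolding class_K_inf_def class_K_def
  by (intro conjI continuous_intros strict_mono_onI
      filterlim_tendsto_pos_mult_at_top[OF tendsto_const] filterlim_ident) auto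

lemma class_K_inf_add:
  assumes "class_K_inf \<gamma>" "class_K_inf \<delta>"
  shows "class_K_inf (\<lambda>r. \<gamma> r + \<delta> r)"
  unfolding class_K_inf_def class_K_def
proof (intro conjI)
  show "continuous_on {0..} (\<lambda>r. \<gamma> r + \<delta> r)"
    using assms unfolding class_K_inf_def class_K_def by (intro continuous_on_add) auto
  show "strict_mono_on {0..} (\<lambda>r. \<gamma> r + \<delta> r)"
    by (intro strict_mono_onI add_strict_mono class_K_strict_mono[OF class_K_infD[OF assms(1)]]
        class_K_strict_mono[OF class_K_infD[OF assms(2)]]) auto
  show "filterlim (\<lambda>r. \<gamma> r + \<delta> r) at_top at_top"
    using assms unfolding class_K_inf_def by (intro filterlim_at_top_add_at_top) auto
qed (use assms in \<open>simp add: class_K_inf_def class_K_def\<close>)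

lemma class_K_inf_compose:
  assumes \<gamma>: "class_K_inf \<gamma>" and \<delta>: "class_K_inf \<delta>"
  shows "class_K_inf (\<lambda>r. \<gamma> (\<delta> r))"
proof -
  have nn: "0 \<le> \<delta> r" if "0 \<le> r" for r using class_K_nonneg[OF class_K_infD[OF \<delta>] that] .
  have "continuous_on {0..} (\<lambda>r. \<gamma> (\<delta> r))"
    by (rule continuous_on_compose2[of "{0..}" \<gamma> "{0..}" \<delta>])
      (use assms nn in \<open>auto simp: class_K_inf_def class_K_def\<close>)
  moreover have "strict_mono_on {0..} (\<lambda>r. \<gamma> (\<delta> r))"
  proof (rule strict_mono_onI)
    fix r s :: real assume rs: "r \<in> {0..}" "s \<in> {0..}" "r < s"
    then have "\<delta> r < \<delta> s" by (intro class_K_strict_mono[OF class_K_infD[OF \<delta>]]) auto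
    then show "\<gamma> (\<delta> r) < \<gamma> (\<delta> s)"
      using nn rs by (intro class_K_strict_mono[OF class_K_infD[OF \<gamma>]]) auto
  qed
  moreover have "filterlim (\<lambda>r. \<gamma> (\<delta> r)) at_top at_top"
    using assms unfolding class_K_inf_def by (auto intro: filterlim_compose)
  ultimately show ?thesis
    using assms by (simp add: class_K_inf_def class_K_def)
qed

lemma class_KL_class_K: "class_KL \<beta> \<Longrightarrow> 0 \<le> s \<Longrightarrow> class_K (\<lambda>r. \<beta> r s)"
  unfolding class_KL_def class_K_inf_def by blast

lemma class_KL_class_K_inf: "class_KL \<beta> \<Longrightarrow> 0 \<le> s \<Longrightarrow> class_K_inf (\<lambda>r. \<beta> r s)"
  unfolding class_KL_def by blast

lemma class_KL_nonneg: "class_KL \<beta> \<Longrightarrow> 0 \<le> r \<Longrightarrow> 0 \<le> s \<Longrightarrow> 0 \<le> \<beta> r s"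
  using class_K_nonneg[OF class_KL_class_K] .

lemma class_KL_antimono:
  assumes "class_KL \<beta>" "0 \<le> r" "0 \<le> s" "s \<le> t"
  shows "\<beta> r t \<le> \<beta> r s"
proof (cases "r = 0")
  case True
  then show ?thesis using class_KL_class_K[OF assms(1)] assms by (simp add: class_K_def)
next
  case False
  then have "antimono_on {0..} (\<beta> r)" using assms unfolding class_KL_def by auto
  then show ?thesis using assms by (auto dest: monotone_onD[of "{0..}" "(\<le>)" "(\<ge>)" "\<beta> r" s t])
qed

lemma class_KL_add:
  assumes "class_KL \<alpha>" "class_KL \<beta>"
  shows "class_KL (\<lambda>r s. \<alpha> r s + \<beta> r s)"
  unfolding class_KL_def
proof (intro conjI allI impI)
  show "continuous_on ({0..} \<times> {0..}) (\<lambda>(r, s). \<alpha> r s + \<beta> r s)"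
    using assms unfolding class_KL_def split_def by (intro continuous_intros) auto
  show "class_K_inf (\<lambda>r. \<alpha> r s + \<beta> r s)" if "0 \<le> s" for s
    using assms that by (intro class_K_inf_add class_KL_class_K_inf[OF assms(1)] class_KL_class_K_inf[OF assms(2)])
  fix r :: real assume r: "0 < r"
  show "antimono_on {0..} (\<lambda>s. \<alpha> r s + \<beta> r s)"
    using r by (intro monotone_onI add_mono class_KL_antimono[OF assms(1)] class_KL_antimono[OF assms(2)]) auto
  have "((\<lambda>s. \<alpha> r s + \<beta> r s) \<longlongrightarrow> 0 + 0) at_top"
    using assms r unfolding class_KL_def by (intro tendsto_add) auto
  then show "((\<lambda>s. \<alpha> r s + \<beta> r s) \<longlongrightarrow> 0) at_top" by simp
qed

lemma class_KL_exp:
  assumes "k > 0" "c > 0"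
  shows "class_KL (\<lambda>r s. k * exp (- c * s) * r)"
  unfolding class_KL_def
proof (intro conjI allI impI)
  show "continuous_on ({0..} \<times> {0..}) (\<lambda>(r, s). k * exp (- c * s) * r)"
    unfolding split_def by (intro continuous_intros)
  show "class_K_inf (\<lambda>r. k * exp (- c * s) * r)" for s
    using assms by (intro class_K_inf_mult) simp
  fix r :: real assume r: "0 < r"
  show "antimono_on {0..} (\<lambda>s. k * exp (- c * s) * r)"
    using assms r by (intro monotone_onI mult_right_mono mult_left_mono) auto
  have "filterlim (\<lambda>s. c * s) at_top at_top"
    using assms by (intro filterlim_tendsto_pos_mult_at_top[OF tendsto_const] filterlim_ident) auto
  then have "((\<lambda>s. exp (- c * s)) \<longlongrightarrow> 0) at_top"
    by (intro filterlim_compose[OF exp_at_bot]) (simp add: filterlim_uminus_at_top)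
  then have "((\<lambda>s. k * exp (- c * s) * r) \<longlongrightarrow> k * 0 * r) at_top"
    by (intro tendsto_intros)
  then show "((\<lambda>s. k * exp (- c * s) * r) \<longlongrightarrow> 0) at_top" by simp
qed

lemma class_KL_compose_outer:
  assumes \<gamma>: "class_K_inf \<gamma>" and \<beta>: "class_KL \<beta>"
  shows "class_KL (\<lambda>r s. \<gamma> (\<beta> r s))"
  unfolding class_KL_def
proof (intro conjI allI impI)
  have c\<gamma>: "continuous_on {0..} \<gamma>" "\<gamma> 0 = 0" using \<gamma> by (auto simp: class_K_inf_def class_K_def)
  have c\<beta>: "continuous_on ({0..} \<times> {0..}) (\<lambda>(r, s). \<beta> r s)" using \<beta> by (simp add: class_KL_def)
  have "continuous_on ({0..} \<times> {0..}) (\<lambda>p. \<gamma> ((\<lambda>(r, s). \<beta> r s) p))"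
    by (rule continuous_on_compose2[OF c\<gamma>(1) c\<beta>]) (auto intro: class_KL_nonneg[OF \<beta>])
  then show "continuous_on ({0..} \<times> {0..}) (\<lambda>(r, s). \<gamma> (\<beta> r s))" by (simp add: split_def)
  show "class_K_inf (\<lambda>r. \<gamma> (\<beta> r s))" if "0 \<le> s" for s
    using \<gamma> class_KL_class_K_inf[OF \<beta> that] by (rule class_K_inf_compose)
  fix r :: real assume r: "0 < r"
  show "antimono_on {0..} (\<lambda>s. \<gamma> (\<beta> r s))"
    using r by (intro monotone_onI class_K_mono[OF class_K_infD[OF \<gamma>]] class_KL_nonneg[OF \<beta>]
        class_KL_antimono[OF \<beta>]) auto
  have "((\<lambda>s. \<gamma> (\<beta> r s)) \<longlongrightarrow> \<gamma> 0) at_top"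
  proof (rule continuous_on_tendsto_compose[OF c\<gamma>(1)])
    show "(\<beta> r \<longlongrightarrow> 0) at_top" using \<beta> r by (simp add: class_KL_def)
    show "\<forall>\<^sub>F s in at_top. \<beta> r s \<in> {0..}"
      using eventually_ge_at_top[of 0] by eventually_elim (use r class_KL_nonneg[OF \<beta>] in auto)
  qed simp
  then show "((\<lambda>s. \<gamma> (\<beta> r s)) \<longlongrightarrow> 0) at_top" by (simp add: c\<gamma>)
qed

lemma class_KL_compose_inner:
  assumes \<beta>: "class_KL \<beta>" and \<kappa>: "class_K_inf \<kappa>" and k: "k > 0"
  shows "class_KL (\<lambda>r s. \<beta> (\<kappa> r) (k * s))"
  unfolding class_KL_def
proof (intro conjI allI impI)
  have c\<kappa>: "continuous_on {0..} \<kappa>" using \<kappa> by (auto simp: class_K_inf_def class_K_def)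
  have nn: "0 \<le> \<kappa> r" if "0 \<le> r" for r using class_K_nonneg[OF class_K_infD[OF \<kappa>] that] .
  have c\<beta>: "continuous_on ({0..} \<times> {0..}) (\<lambda>(r, s). \<beta> r s)" using \<beta> by (simp add: class_KL_def)
  have "continuous_on ({0..} \<times> {0..}) (\<lambda>p. \<kappa> (fst p))"
    by (rule continuous_on_compose2[OF c\<kappa>]) (auto intro!: continuous_intros)
  then have "continuous_on ({0..} \<times> {0..}) (\<lambda>p. (\<kappa> (fst p), k * snd p))"
    by (intro continuous_intros)
  moreover have "(\<lambda>p. (\<kappa> (fst p), k * snd p)) ` ({0..} \<times> {0..}) \<subseteq> {0..} \<times> {0..}"
  proof (rule image_subsetI)
    fix p :: "real \<times> real" assume "p \<in> {0..} \<times> {0..}"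
    then have "0 \<le> fst p" "0 \<le> snd p" by auto
    then show "(\<kappa> (fst p), k * snd p) \<in> {0..} \<times> {0..}" using nn[of "fst p"] k by simp
  qed
  ultimately have "continuous_on ({0..} \<times> {0..}) (\<lambda>p. (\<lambda>(r, s). \<beta> r s) (\<kappa> (fst p), k * snd p))"
    by (rule continuous_on_compose2[OF c\<beta>])
  then show "continuous_on ({0..} \<times> {0..}) (\<lambda>(r, s). \<beta> (\<kappa> r) (k * s))"
    by (simp add: split_def)
  show "class_K_inf (\<lambda>r. \<beta> (\<kappa> r) (k * s))" if "0 \<le> s" for s
    by (rule class_K_inf_compose[OF class_KL_class_K_inf[OF \<beta>] \<kappa>]) (use that k in simp)
  fix r :: real assume r: "0 < r"
  show "antimono_on {0..} (\<lambda>s. \<beta> (\<kappa> r) (k * s))"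
    using r k nn by (intro monotone_onI class_KL_antimono[OF \<beta>]) auto
  have "0 < \<kappa> r"
    using class_K_strict_mono[OF class_K_infD[OF \<kappa>], of 0 r] \<kappa> r by (simp add: class_K_inf_def class_K_def)
  then have "(\<beta> (\<kappa> r) \<longlongrightarrow> 0) at_top" using \<beta> by (simp add: class_KL_def)
  moreover have "filterlim (\<lambda>s. k * s) at_top at_top"
    using k by (intro filterlim_tendsto_pos_mult_at_top[OF tendsto_const] filterlim_ident) auto
  ultimately show "((\<lambda>s. \<beta> (\<kappa> r) (k * s)) \<longlongrightarrow> 0) at_top"
    by (rule filterlim_compose)
qed

section \<open>The essential supremum of an input\<close>

text \<open>
  An essential supremum over a null set would be \<open>-\<infinity>\<close>; the half line is not a null set.
\<close>
lemma sup_norm_nonneg: "0 \<le> sup_norm g"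
proof (rule ccontr)
  assume "\<not> 0 \<le> sup_norm g"
  then have neg: "sup_norm g < 0" by simp
  have "AE t in lebesgue_on {0..}. ereal (norm (g t)) \<le> sup_norm g"
    unfolding sup_norm_def by (rule esssup_AE)
  then have "AE t in lebesgue_on {0::real..}. False"
  proof eventually_elim
    case (elim t)
    then have "ereal (norm (g t)) < 0" using neg by (rule le_less_trans)
    then show ?case by simp
  qed
  then have "negligible {0::real..}" by (subst (asm) AE_lebesgue_on_iff_negligible) (auto simp: atLeast_def)
  then have "negligible {0<..<1::real}" by (rule negligible_subset) auto
  then show False using open_not_negligible[of "{0<..<1::real}"] by auto
qed

lemma sup_norm_AE:
  assumes "sup_norm g < \<infinity>"
  shows "AE t in lebesgue_on {0..}. norm (g t) \<le> real_of_ereal (sup_norm g)"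
proof -
  have eq: "sup_norm g = ereal (real_of_ereal (sup_norm g))"
    using assms sup_norm_nonneg[of g] by (cases "sup_norm g") auto
  have "AE t in lebesgue_on {0..}. ereal (norm (g t)) \<le> sup_norm g"
    unfolding sup_norm_def by (rule esssup_AE)
  then show ?thesis by (subst (asm) eq) simp
qed

lemma sup_norm_le:
  fixes g :: "real \<Rightarrow> 'u::euclidean_space"
  assumes "continuous_on {0..} g" and "\<And>t. 0 \<le> t \<Longrightarrow> norm (g t) \<le> W"
  shows "sup_norm g \<le> ereal W"
  unfolding sup_norm_def
proof (rule esssup_I)
  have "(\<lambda>t. norm (g t)) \<in> borel_measurable (lebesgue_on {0..})"
    using assms(1) by (intro continuous_imp_measurable_on_sets_lebesgue continuous_intros) auto
  then show "(\<lambda>t. ereal (norm (g t))) \<in> borel_measurable (lebesgue_on {0..})" by measurable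
  show "AE t in lebesgue_on {0..}. ereal (norm (g t)) \<le> ereal W"
    using assms(2) by (intro AE_I2) (simp add: space_restrict_space)
qed

section \<open>Incremental estimates\<close>

text \<open>
  The estimate in the definition of \<open>delta_ISS\<close>, separated from forward completeness so that
  the metric and the comparison functions can be named.
\<close>
definition incremental_estimate ::
  "('x::euclidean_space \<Rightarrow> 'u::euclidean_space \<Rightarrow> 'x) \<Rightarrow> ('x \<Rightarrow> 'x \<Rightarrow> real) \<Rightarrow>
   (real \<Rightarrow> real \<Rightarrow> real) \<Rightarrow> (real \<Rightarrow> real) \<Rightarrow> bool" where
  "incremental_estimate F d \<beta> \<gamma> \<longleftrightarrow>
     (\<forall>a a' \<upsilon> \<upsilon>' \<xi> \<xi>' t.
           a < 0 \<and> a' < 0 \<and> trajectory UNIV F a \<infinity> \<upsilon> \<xi> \<and> trajectory UNIV F a' \<infinity> \<upsilon>' \<xi>' \<and> 0 \<le> t \<and>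
           sup_norm (\<lambda>s. \<upsilon> s - \<upsilon>' s) < \<infinity> \<longrightarrow>
           d (\<xi> t) (\<xi>' t) \<le> \<beta> (d (\<xi> 0) (\<xi>' 0)) t +
             \<gamma> (real_of_ereal (sup_norm (\<lambda>s. \<upsilon> s - \<upsilon>' s))))"

lemma trajectory_shift:
  fixes F :: "'x::euclidean_space \<Rightarrow> 'u::euclidean_space \<Rightarrow> 'x"
  assumes F: "continuous_on (UNIV \<times> UNIV) (\<lambda>(x, u). F x u)" and "0 \<le> \<tau>"
    and w: "continuous_on {q<..} w" and y: "trajectory UNIV F (ereal q) \<infinity> w y"
  shows "trajectory UNIV F (ereal q) \<infinity> (\<lambda>t. w (t + \<tau>)) (\<lambda>t. y (t + \<tau>))"
proof -
  have "continuous_on {q<..} (\<lambda>t. w (t + \<tau>))"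
    using \<open>0 \<le> \<tau>\<close> by (intro continuous_on_compose2[OF w]) (auto intro!: continuous_intros)
  then have "admissible_input UNIV (ereal q) \<infinity> (\<lambda>t. w (t + \<tau>))"
    by (intro continuous_imp_admissible_input) simp
  moreover have "ae_primitive {q<..} (\<lambda>t. F (y (t + \<tau>)) (w (t + \<tau>))) (\<lambda>t. y (t + \<tau>))"
    using y \<open>0 \<le> \<tau>\<close> unfolding trajectory_iff_ae_primitive[OF F]
    by (intro ae_primitive_shift[where g = "\<lambda>t. F (y t) (w t)" and S = "{q<..}"]) auto
  ultimately show ?thesis by (simp add: trajectory_iff_ae_primitive[OF F])
qed

text \<open>
  The estimate restarted at time \<open>\<tau>\<close>.  It involves the inputs after \<open>\<tau>\<close> only, which is the
  reason for restarting: the difference of the inputs may have decayed by then.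
\<close>
lemma incremental_estimate_from:
  fixes F :: "'x::euclidean_space \<Rightarrow> 'u::euclidean_space \<Rightarrow> 'x"
  assumes est: "incremental_estimate F d \<beta> \<gamma>" and \<gamma>: "class_K \<gamma>"
    and F: "continuous_on (UNIV \<times> UNIV) (\<lambda>(x, u). F x u)"
    and q: "q < 0" and w: "continuous_on {q<..} w" "continuous_on {q<..} w'"
    and y: "trajectory UNIV F (ereal q) \<infinity> w y" "trajectory UNIV F (ereal q) \<infinity> w' y'"
    and "0 \<le> \<tau>" "0 \<le> s" and W: "\<And>u. \<tau> \<le> u \<Longrightarrow> norm (w u - w' u) \<le> W"
  shows "d (y (s + \<tau>)) (y' (s + \<tau>)) \<le> \<beta> (d (y \<tau>) (y' \<tau>)) s + \<gamma> W"
proof -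
  let ?g = "\<lambda>t. w (t + \<tau>) - w' (t + \<tau>)"
  have "continuous_on {0..} (\<lambda>t. w (t + \<tau>))" "continuous_on {0..} (\<lambda>t. w' (t + \<tau>))"
    using \<open>0 \<le> \<tau>\<close> q by (auto intro!: continuous_on_compose2[OF w(1)] continuous_on_compose2[OF w(2)] continuous_intros)
  then have le: "sup_norm ?g \<le> ereal W"
    using W \<open>0 \<le> \<tau>\<close> by (intro sup_norm_le continuous_intros) auto
  then have fin: "sup_norm ?g < \<infinity>" by (auto intro: le_less_trans)
  have "0 \<le> real_of_ereal (sup_norm ?g)" "real_of_ereal (sup_norm ?g) \<le> W"
    using le sup_norm_nonneg[of ?g] by (cases "sup_norm ?g"; simp)+
  then have "\<gamma> (real_of_ereal (sup_norm ?g)) \<le> \<gamma> W" by (rule class_K_mono[OF \<gamma>])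
  moreover have "d (y (s + \<tau>)) (y' (s + \<tau>)) \<le> \<beta> (d (y (0 + \<tau>)) (y' (0 + \<tau>))) s + \<gamma> (real_of_ereal (sup_norm ?g))"
    using est[unfolded incremental_estimate_def, rule_format, of "ereal q" "ereal q" "\<lambda>t. w (t + \<tau>)"
        "\<lambda>t. y (t + \<tau>)" "\<lambda>t. w' (t + \<tau>)" "\<lambda>t. y' (t + \<tau>)" s]
      trajectory_shift[OF F \<open>0 \<le> \<tau>\<close> w(1) y(1)] trajectory_shift[OF F \<open>0 \<le> \<tau>\<close> w(2) y(2)]
      fin q \<open>0 \<le> s\<close>
    by (simp add: zero_ereal_def)
  ultimately show ?thesis by simp
qed

lemma delta_ISS_iff:
  "delta_ISS UNIV F \<longleftrightarrow> forward_complete UNIV F \<and>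
     (\<exists>d \<beta> \<gamma>. Metric_space UNIV d \<and> class_KL \<beta> \<and> class_K_inf \<gamma> \<and> incremental_estimate F d \<beta> \<gamma>)"
  unfolding delta_ISS_def incremental_estimate_def ..

lemma trajectory_restrict_left:
  fixes F :: "'x::euclidean_space \<Rightarrow> 'u::euclidean_space \<Rightarrow> 'x"
  assumes F: "continuous_on (UNIV \<times> UNIV) (\<lambda>(x, u). F x u)"
    and y: "trajectory UNIV F a \<infinity> w y" and a: "a \<le> a'"
  shows "trajectory UNIV F a' \<infinity> w y"
proof -
  have "einterval a' \<infinity> \<subseteq> einterval a \<infinity>" using a by (auto simp: einterval_iff)
  then show ?thesis
    using y unfolding trajectory_iff_ae_primitive[OF F]
    by (auto intro: admissible_input_subset ae_primitive_subset)
qed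

section \<open>The estimate for the closed loop\<close>

text \<open>
  The bookkeeping of the two applications of the estimate.  Here \<open>d0\<close>, \<open>dm\<close> and \<open>dt\<close> are the
  distances in the subsystem at times \<open>0\<close>, \<open>t/2\<close> and \<open>t\<close>, \<open>z0\<close> is the initial difference of the
  tracking errors, \<open>e\<close> is its decay factor up to time \<open>t/2\<close>, and \<open>V\<close> is the contribution of
  the inputs.  Each sum inside a comparison function is split, and \<open>d0\<close> and \<open>z0\<close> are both
  replaced by the combined initial distance \<open>d0 + z0\<close>.
\<close>
lemma cascade_comparison:
  assumes \<beta>: "class_KL \<beta>" and \<gamma>: "class_K \<gamma>"
    and nn: "0 \<le> d0" "0 \<le> z0" "0 \<le> V" "0 \<le> t" "0 \<le> e" "0 \<le> dm"
    and dm: "dm \<le> \<beta> d0 (t / 2) + \<gamma> (z0 + V)"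
    and dt: "dt \<le> \<beta> dm (t / 2) + \<gamma> (e * z0 + V)"
  shows "dt \<le> \<beta> (2 * (\<beta> (d0 + z0) 0 + \<gamma> (2 * (d0 + z0)))) (t / 2) + \<gamma> (2 * e * (d0 + z0))
    + (\<beta> (2 * \<gamma> (2 * V)) 0 + \<gamma> (2 * V))"
proof -
  define \<kappa> where "\<kappa> = \<beta> (d0 + z0) 0 + \<gamma> (2 * (d0 + z0))"
  have \<beta>0: "class_K (\<lambda>r. \<beta> r 0)" "class_K (\<lambda>r. \<beta> r (t / 2))"
    using nn by (auto intro: class_KL_class_K[OF \<beta>])
  have \<kappa>nn: "0 \<le> \<kappa>" unfolding \<kappa>_def
    using nn by (intro add_nonneg_nonneg class_KL_nonneg[OF \<beta>] class_K_nonneg[OF \<gamma>]) auto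
  have gnn: "0 \<le> \<gamma> (2 * V)" using nn by (intro class_K_nonneg[OF \<gamma>]) auto
  have "\<beta> d0 (t / 2) \<le> \<beta> d0 0" using nn by (intro class_KL_antimono[OF \<beta>]) auto
  also have "\<dots> \<le> \<beta> (d0 + z0) 0" using nn by (intro class_K_mono[OF \<beta>0(1)]) auto
  finally have 1: "\<beta> d0 (t / 2) \<le> \<beta> (d0 + z0) 0" .
  have "\<gamma> (z0 + V) \<le> \<gamma> (2 * z0) + \<gamma> (2 * V)" using nn by (intro class_K_add_le[OF \<gamma>])
  moreover have "\<gamma> (2 * z0) \<le> \<gamma> (2 * (d0 + z0))" using nn by (intro class_K_mono[OF \<gamma>]) auto
  ultimately have "dm \<le> \<kappa> + \<gamma> (2 * V)" using 1 dm by (simp add: \<kappa>_def)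
  then have "\<beta> dm (t / 2) \<le> \<beta> (\<kappa> + \<gamma> (2 * V)) (t / 2)"
    using nn by (intro class_K_mono[OF \<beta>0(2)])
  also have "\<dots> \<le> \<beta> (2 * \<kappa>) (t / 2) + \<beta> (2 * \<gamma> (2 * V)) (t / 2)"
    by (rule class_K_add_le[OF \<beta>0(2) \<kappa>nn gnn])
  also have "\<beta> (2 * \<gamma> (2 * V)) (t / 2) \<le> \<beta> (2 * \<gamma> (2 * V)) 0"
    using gnn nn by (intro class_KL_antimono[OF \<beta>]) auto
  finally have 2: "\<beta> dm (t / 2) \<le> \<beta> (2 * \<kappa>) (t / 2) + \<beta> (2 * \<gamma> (2 * V)) 0" by simp
  have "\<gamma> (e * z0 + V) \<le> \<gamma> (2 * (e * z0)) + \<gamma> (2 * V)" using nn by (intro class_K_add_le[OF \<gamma>]) auto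
  moreover have "2 * (e * z0) \<le> 2 * e * (d0 + z0)" using nn by (simp add: algebra_simps)
  then have "\<gamma> (2 * (e * z0)) \<le> \<gamma> (2 * e * (d0 + z0))" using nn by (intro class_K_mono[OF \<gamma>]) auto
  ultimately show ?thesis using dt 2 unfolding \<kappa>_def by linarith
qed

text \<open>
  The last summands of the two comparison functions bound the difference of the tracking errors,
  the others the distance in the subsystem.
\<close>
lemma closed_loop_incremental_estimate:
  fixes f :: "real^'n \<Rightarrow> real^'m \<Rightarrow> real^'n"
  assumes f: "continuous_on UNIV (\<lambda>(\<eta>, \<zeta>). f \<eta> \<zeta>)" and \<psi>: "continuously_differentiable \<psi>"
    and cont: "continuous_on (UNIV \<times> UNIV) (\<lambda>(\<eta>, u). f \<eta> (\<psi> \<eta> + u))"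
    and c: "c > 0" and d: "Metric_space UNIV d" and \<beta>: "class_KL \<beta>" and \<gamma>: "class_K_inf \<gamma>"
    and est: "incremental_estimate (\<lambda>\<eta> u. f \<eta> (\<psi> \<eta> + u)) d \<beta> \<gamma>"
  shows "incremental_estimate (closed_loop (integrator_system f) (backstepping_feedback c \<psi> f))
    (\<lambda>x y. d (fst x) (fst y) + norm ((snd x - \<psi> (fst x)) - (snd y - \<psi> (fst y))))
    (\<lambda>r t. \<beta> (2 * (\<beta> r 0 + \<gamma> (2 * r))) (t / 2) + \<gamma> (2 * exp (- (c / 2) * t) * r) + exp (- c * t) * r)
    (\<lambda>V. \<beta> (2 * \<gamma> (2 * (V / c))) 0 + \<gamma> (2 * (V / c)) + V / c)"
    (is "incremental_estimate ?F ?D ?B ?G")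
  unfolding incremental_estimate_def
proof (intro allI impI, elim conjE)
  let ?H = "\<lambda>\<eta> u. f \<eta> (\<psi> \<eta> + u)"
  fix a a' v v' x x' and t :: real
  assume a: "a < (0::ereal)" "a' < (0::ereal)" and x: "trajectory UNIV ?F a \<infinity> v x"
    and x': "trajectory UNIV ?F a' \<infinity> v' x'" and t: "0 \<le> t"
    and fin: "sup_norm (\<lambda>s. v s - v' s) < \<infinity>"
  \<comment> \<open>The two trajectories may have different intervals of definition; both are restricted to \<open>]q,\<infinity>[\<close>.\<close>
  obtain q where q: "max a a' < ereal q" "ereal q < 0"
    using ereal_dense2[of "max a a'" 0] a by auto
  then have "q < 0" by simp
  note contF = closed_loop_continuous[OF f \<psi>, of c]
  have xq: "trajectory UNIV ?F (ereal q) \<infinity> v x" "trajectory UNIV ?F (ereal q) \<infinity> v' x'"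
    using q by (auto intro!: trajectory_restrict_left[OF contF x] trajectory_restrict_left[OF contF x'])
  define z where "z = (\<lambda>t. snd (x t) - \<psi> (fst (x t)))"
  define z' where "z' = (\<lambda>t. snd (x' t) - \<psi> (fst (x' t)))"
  have z: "ae_primitive {q<..} (\<lambda>t. - c *\<^sub>R z t + v t) z" "trajectory UNIV ?H (ereal q) \<infinity> z (\<lambda>t. fst (x t))"
    using closed_loop_trajectoryD[OF f \<psi> cont xq(1)] by (simp_all add: z_def)
  have z': "ae_primitive {q<..} (\<lambda>t. - c *\<^sub>R z' t + v' t) z'" "trajectory UNIV ?H (ereal q) \<infinity> z' (\<lambda>t. fst (x' t))"
    using closed_loop_trajectoryD[OF f \<psi> cont xq(2)] by (simp_all add: z'_def)
  have cz: "continuous_on {q<..} z" "continuous_on {q<..} z'"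
    using ae_primitive_continuous_on_open[OF z(1)] ae_primitive_continuous_on_open[OF z'(1)] by auto
  define V where "V = real_of_ereal (sup_norm (\<lambda>s. v s - v' s))"
  have V: "0 \<le> V" unfolding V_def using sup_norm_nonneg by (rule real_of_ereal_pos)
  define N where "N = {s \<in> {0..}. \<not> norm (v s - v' s) \<le> V}"
  have N: "negligible N"
    using sup_norm_AE[OF fin] unfolding N_def V_def by (subst (asm) AE_lebesgue_on_iff_negligible) auto
  define z0 where "z0 = norm (z 0 - z' 0)"
  have "ae_primitive {q<..} (\<lambda>s. - c *\<^sub>R (z s - z' s) + (v s - v' s)) (\<lambda>s. z s - z' s)"
    using ae_primitive_diff[OF z(1) z'(1)] by (simp add: algebra_simps)
  then have decay: "norm (z s - z' s) \<le> exp (- c * s) * z0 + V / c" if "0 \<le> s" for s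
    using ae_primitive_linear_decay[where s = 0 and t = s and N = N and V = V] that \<open>q < 0\<close> c N V
    by (force simp: N_def z0_def)
  have "0 \<le> z0" by (simp add: z0_def)
  have nnd: "0 \<le> d p r" for p r using d by (simp add: Metric_space.nonneg)
  note delayed = incremental_estimate_from[OF est class_K_infD[OF \<gamma>] cont \<open>q < 0\<close> cz z(2) z'(2)]
  have half: "d (fst (x (t/2))) (fst (x' (t/2))) \<le> \<beta> (d (fst (x 0)) (fst (x' 0))) (t/2) + \<gamma> (z0 + V / c)"
  proof -
    have "norm (z u - z' u) \<le> z0 + V / c" if "0 \<le> u" for u
    proof -
      have "exp (- c * u) * z0 \<le> 1 * z0"
        using c that \<open>0 \<le> z0\<close> by (intro mult_right_mono) auto
      then show ?thesis using decay[OF that] by linarith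
    qed
    then show ?thesis using delayed[of 0 "t/2" "z0 + V / c"] t by simp
  qed
  have full: "d (fst (x t)) (fst (x' t)) \<le> \<beta> (d (fst (x (t/2))) (fst (x' (t/2)))) (t/2)
      + \<gamma> (exp (- (c / 2) * t) * z0 + V / c)"
  proof -
    have "norm (z u - z' u) \<le> exp (- (c / 2) * t) * z0 + V / c" if "t / 2 \<le> u" for u
    proof -
      have "c * (t / 2) \<le> c * u" using c that by (intro mult_left_mono) auto
      then have "exp (- c * u) * z0 \<le> exp (- (c / 2) * t) * z0"
        using \<open>0 \<le> z0\<close> by (intro mult_right_mono) auto
      then show ?thesis using decay[of u] that t by linarith
    qed
    then show ?thesis using delayed[of "t/2" "t/2"] t by simp
  qed
  let ?r = "d (fst (x 0)) (fst (x' 0)) + z0"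
  have "d (fst (x t)) (fst (x' t)) \<le> \<beta> (2 * (\<beta> ?r 0 + \<gamma> (2 * ?r))) (t / 2)
      + \<gamma> (2 * exp (- (c / 2) * t) * ?r) + (\<beta> (2 * \<gamma> (2 * (V / c))) 0 + \<gamma> (2 * (V / c)))"
    using nnd \<open>0 \<le> z0\<close> V c t
    by (intro cascade_comparison[OF \<beta> class_K_infD[OF \<gamma>] _ _ _ _ _ _ half full]) auto
  moreover have "norm (z t - z' t) \<le> exp (- c * t) * ?r + V / c"
  proof -
    have "exp (- c * t) * z0 \<le> exp (- c * t) * ?r" using nnd by (intro mult_left_mono) auto
    then show ?thesis using decay[OF t] by linarith
  qed
  ultimately show "?D (x t) (x' t) \<le> ?B (?D (x 0) (x' 0)) t + ?G (real_of_ereal (sup_norm (\<lambda>s. v s - v' s)))"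
    unfolding z_def z'_def z0_def V_def by simp
qed

text \<open>
  This is the sum metric of \<open>d\<close> and the norm, pulled back along the bijection
  \<open>(\<eta>, \<zeta>) \<mapsto> (\<eta>, \<zeta> - \<psi>(\<eta>))\<close>.
\<close>
lemma Metric_space_tracking_error:
  fixes \<psi> :: "'a \<Rightarrow> 'b::real_normed_vector"
  assumes "Metric_space UNIV d"
  shows "Metric_space UNIV (\<lambda>x y. d (fst x) (fst y) + norm ((snd x - \<psi> (fst x)) - (snd y - \<psi> (fst y))))"
proof -
  interpret Metric_space UNIV d by fact
  show ?thesis
  proof
    fix x y w :: "'a \<times> 'b"
    show "0 \<le> d (fst x) (fst y) + norm ((snd x - \<psi> (fst x)) - (snd y - \<psi> (fst y)))" by simp
    show "d (fst x) (fst y) + norm ((snd x - \<psi> (fst x)) - (snd y - \<psi> (fst y))) =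
        d (fst y) (fst x) + norm ((snd y - \<psi> (fst y)) - (snd x - \<psi> (fst x)))"
      by (simp add: commute norm_minus_commute)
    show "d (fst x) (fst y) + norm ((snd x - \<psi> (fst x)) - (snd y - \<psi> (fst y))) = 0 \<longleftrightarrow> x = y"
    proof
      assume "d (fst x) (fst y) + norm ((snd x - \<psi> (fst x)) - (snd y - \<psi> (fst y))) = 0"
      then have "d (fst x) (fst y) = 0 \<and> norm ((snd x - \<psi> (fst x)) - (snd y - \<psi> (fst y))) = 0"
        by (subst (asm) add_nonneg_eq_0_iff) (rule nonneg, rule norm_ge_zero)
      then have "fst x = fst y" "snd x - \<psi> (fst x) = snd y - \<psi> (fst y)"
        by (simp, simp only: norm_eq_zero right_minus_eq)
      then show "x = y" by (metis diff_add_cancel prod_eqI)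
    qed simp
    have "norm ((snd x - \<psi> (fst x)) - (snd w - \<psi> (fst w))) \<le>
        norm ((snd x - \<psi> (fst x)) - (snd y - \<psi> (fst y))) + norm ((snd y - \<psi> (fst y)) - (snd w - \<psi> (fst w)))"
      by (rule norm_diff_triangle_le) auto
    moreover have "d (fst x) (fst w) \<le> d (fst x) (fst y) + d (fst y) (fst w)" by (simp add: triangle)
    ultimately show "d (fst x) (fst w) + norm ((snd x - \<psi> (fst x)) - (snd w - \<psi> (fst w))) \<le>
        (d (fst x) (fst y) + norm ((snd x - \<psi> (fst x)) - (snd y - \<psi> (fst y)))) +
        (d (fst y) (fst w) + norm ((snd y - \<psi> (fst y)) - (snd w - \<psi> (fst w))))" by simp
  qed
qed

theorem theorem4p2:
  fixes f :: "real^'n \<Rightarrow> real^'m \<Rightarrow> real^'n"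
    and \<psi> :: "real^'n \<Rightarrow> real^'m"
  assumes "control_system UNIV (integrator_system f)"
    and "continuously_differentiable \<psi>"
    and "control_system UNIV (\<lambda>\<eta> u. f \<eta> (\<psi> \<eta> + u))"
    and "delta_ISS UNIV (\<lambda>\<eta> u. f \<eta> (\<psi> \<eta> + u))"
  shows "\<forall>c>0. delta_ISS UNIV (closed_loop (integrator_system f) (backstepping_feedback c \<psi> f))"
proof (intro allI impI)
  fix c :: real assume c: "c > 0"
  note f = continuous_on_of_integrator_system[OF assms(1)]
  note cont = continuous_on_control_system[OF assms(3)]
  obtain d \<beta> \<gamma> where fc: "forward_complete UNIV (\<lambda>\<eta> u. f \<eta> (\<psi> \<eta> + u))"
    and d: "Metric_space UNIV d" and \<beta>: "class_KL \<beta>" and \<gamma>: "class_K_inf \<gamma>"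
    and est: "incremental_estimate (\<lambda>\<eta> u. f \<eta> (\<psi> \<eta> + u)) d \<beta> \<gamma>"
    using assms(4) unfolding delta_ISS_iff by blast
  have \<beta>0: "class_K_inf (\<lambda>r. \<beta> r 0)" using \<beta> by (rule class_KL_class_K_inf) simp
  have \<gamma>2: "class_K_inf (\<lambda>r. \<gamma> (2 * r))" by (rule class_K_inf_compose[OF \<gamma> class_K_inf_mult]) simp
  have \<kappa>: "class_K_inf (\<lambda>r. 2 * (\<beta> r 0 + \<gamma> (2 * r)))"
    by (rule class_K_inf_compose[OF class_K_inf_mult class_K_inf_add[OF \<beta>0 \<gamma>2]]) simp
  have KL1: "class_KL (\<lambda>r t. \<beta> (2 * (\<beta> r 0 + \<gamma> (2 * r))) (t / 2))"
    using class_KL_compose_inner[OF \<beta> \<kappa>, of "1 / 2"] by simp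
  have KL2: "class_KL (\<lambda>r t. \<gamma> (2 * exp (- (c / 2) * t) * r))"
    by (rule class_KL_compose_outer[OF \<gamma> class_KL_exp]) (use c in simp_all)
  have KL3: "class_KL (\<lambda>r t. exp (- c * t) * r)"
    using class_KL_exp[of 1 c] c by simp
  note KL = class_KL_add[OF class_KL_add[OF KL1 KL2] KL3]
  have lin: "class_K_inf (\<lambda>V. V / c)"
    using class_K_inf_mult[of "1 / c"] c by simp
  have \<gamma>c: "class_K_inf (\<lambda>V. \<gamma> (2 * (V / c)))"
    by (rule class_K_inf_compose[OF \<gamma>2 lin])
  have "class_K_inf (\<lambda>V. 2 * \<gamma> (2 * (V / c)))"
    by (rule class_K_inf_compose[OF class_K_inf_mult \<gamma>c]) simp
  note K = class_K_inf_add[OF class_K_inf_add[OF class_K_inf_compose[OF \<beta>0 this] \<gamma>c] lin]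
  show "delta_ISS UNIV (closed_loop (integrator_system f) (backstepping_feedback c \<psi> f))"
    unfolding delta_ISS_iff
    using closed_loop_forward_complete[OF f assms(2) cont fc] Metric_space_tracking_error[OF d] KL K
      closed_loop_incremental_estimate[OF f assms(2) cont c d \<beta> \<gamma> est]
    by blast
qed

end
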